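(* Let $(\Omega,\mathcal{A},\mu,T)$ be an aperiodic dynamical system on a Lebesgue probability space and let $(a_n)_{n\in\mathbb{N}}\subset\mathbb{R}_+$ be an increasing sequence such that $a_n\nearrow\infty$ and $\frac{a_n}{n}\to 0$ as $n\to\infty$. Then for every $\varepsilon>0$ there exists a set $A\in\mathcal{A}$ with $\mu(A)<\varepsilon$ such that for every probability measure $\nu$ on $\mathbb{R}$ there exists a sequence of positive integers $(n_k)_{k\in\mathbb{N}}$ such that $$\frac{1}{a_{n_k}}S_{n_k}\big(\mathbf{1}_A-\mu(A)\big)\ \longrightarrow\ \nu\quad\text{in distribution as } k\to\infty .$$
   Context: A dynamical system $(\Omega,\mathcal{A},\mu,T)$ consists of a probability space $(\Omega,\mathcal{A},\mu)$ where $\Omega$ is a Lebesgue space, and an invertible measure preserving transformation $T:\Omega\to\Omega$. It is aperiodic if $\mu\{x\in\Omega : \exists n\ge 1,\ T^n x=x\}=0$. Ergodicity is not assumed. For a random variable $X:\Omega\to\mathbb{R}$ and $n\ge 1$, $S_n(X)=\sum_{i=0}^{n-1}X\circ T^i$. $\mathbf{1}_A$ is the indicator function of $A$. $\mathbb{R}_+$ denotes the positive reals. Convergence in distribution means that the laws under $\mu$ of the random variables on the left converge weakly to $\nu$. *)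

theory Defs
  imports "HOL-Probability.Probability"
begin

text \<open>
  Isomorphism modulo null sets: after removing a null set on each side, there is a bimeasurable
  bijection carrying one measure to the other.
\<close>

definition isomorphic_mod0 :: "'a measure \<Rightarrow> 'b measure \<Rightarrow> bool" where
  "isomorphic_mod0 M N \<longleftrightarrow>
     (\<exists>X\<in>sets M. \<exists>Y\<in>sets N. \<exists>\<phi>.
        space M - X \<in> null_sets M \<and> space N - Y \<in> null_sets N \<and>
        bij_betw \<phi> X Y \<and>
        \<phi> \<in> measurable (restrict_space M X) (restrict_space N Y) \<and>
        the_inv_into X \<phi> \<in> measurable (restrict_space N Y) (restrict_space M X) \<and>
        distr (restrict_space M X) (restrict_space N Y) \<phi> = restrict_space N Y)"

text \<open>
  Lebesgue spaces in the sense of Rokhlin: complete probability spaces consisting of countably many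
  atoms \<open>C\<close> (possibly none) and a part isomorphic modulo null sets to an interval \<open>[0, s]\<close> with
  Lebesgue measure on the Lebesgue sigma-algebra.  Preservation of measure forces
  \<open>s = 1 - measure M C\<close>; the case \<open>s = 0\<close> is the purely atomic one.
\<close>

definition lebesgue_space :: "'a measure \<Rightarrow> bool" where
  "lebesgue_space M \<longleftrightarrow>
     prob_space M \<and> complete_measure M \<and>
     (\<exists>C s. countable C \<and> C \<subseteq> space M \<and>
        (\<forall>x\<in>C. {x} \<in> sets M \<and> emeasure M {x} > 0) \<and>
        s \<ge> 0 \<and> isomorphic_mod0 (restrict_space M (space M - C)) (lebesgue_on {0..s::real}))"

definition invertible_measure_preserving :: "'a measure \<Rightarrow> ('a \<Rightarrow> 'a) \<Rightarrow> bool" where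
  "invertible_measure_preserving M T \<longleftrightarrow>
     bij_betw T (space M) (space M) \<and>
     T \<in> measurable M M \<and> the_inv_into (space M) T \<in> measurable M M \<and>
     distr M M T = M"

definition dynamical_system :: "'a measure \<Rightarrow> ('a \<Rightarrow> 'a) \<Rightarrow> bool" where
  "dynamical_system M T \<longleftrightarrow> lebesgue_space M \<and> invertible_measure_preserving M T"

definition aperiodic :: "'a measure \<Rightarrow> ('a \<Rightarrow> 'a) \<Rightarrow> bool" where
  "aperiodic M T \<longleftrightarrow> {x \<in> space M. \<exists>n\<ge>1. (T ^^ n) x = x} \<in> null_sets M"

definition birkhoff_sum :: "('a \<Rightarrow> 'a) \<Rightarrow> ('a \<Rightarrow> real) \<Rightarrow> nat \<Rightarrow> 'a \<Rightarrow> real" where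
  "birkhoff_sum T X n = (\<lambda>x. \<Sum>i<n. X ((T ^^ i) x))"

text \<open>
  Measurability of the normalised sums: without it, the image measures under them would carry no
  information.
\<close>

lemma birkhoff_sum_measurable [measurable]:
  assumes [measurable]: "T \<in> measurable M M" "X \<in> borel_measurable M"
  shows "birkhoff_sum T X n \<in> borel_measurable M"
proof -
  have [measurable]: "(T ^^ i) \<in> measurable M M" for i
    by (induction i) (auto intro: measurable_comp[OF _ assms(1)])
  show ?thesis unfolding birkhoff_sum_def by measurable
qed

lemma isomorphic_mod0_refl: "isomorphic_mod0 M M"
  unfolding isomorphic_mod0_def
proof (intro bexI exI[where x = id] conjI)
  have "the_inv_into (space M) id x = x" if "x \<in> space M" for x
    using that by (metis id_apply inj_on_id the_inv_into_f_f)
  then show "the_inv_into (space M) id \<in> measurable (restrict_space M (space M)) (restrict_space M (space M))"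
    by (subst measurable_cong[where g = "\<lambda>x. x"]) (auto simp: space_restrict_space)
  show "distr (restrict_space M (space M)) (restrict_space M (space M)) id = restrict_space M (space M)"
    unfolding id_def by (rule distr_id)
qed (auto simp: id_def bij_betw_def)

lemma lebesgue_space_unit_interval: "lebesgue_space (lebesgue_on {0..1::real})"
proof -
  let ?M = "lebesgue_on {0..1::real}"
  have "emeasure ?M (space ?M) = 1"
    by (simp add: space_restrict_space emeasure_restrict_space)
  then have "prob_space ?M" by (rule prob_spaceI)
  moreover have "complete_measure ?M"
  proof
    fix A B assume "B \<subseteq> A" "A \<in> null_sets ?M"
    then have "A \<in> null_sets lebesgue" "A \<subseteq> {0..1}"
      by (auto simp: null_sets_restrict_space)
    with \<open>B \<subseteq> A\<close> show "B \<in> sets ?M"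
      by (auto simp: sets_restrict_space_iff intro: completion.complete)
  qed
  moreover have "isomorphic_mod0 (restrict_space ?M (space ?M - {})) ?M"
    using isomorphic_mod0_refl[of ?M] by (simp add: restrict_restrict_space)
  ultimately show ?thesis
    unfolding lebesgue_space_def by (intro conjI exI[where x = "{}"] exI[where x = "1::real"]) auto
qed

end

theory Submission
  imports Defs
begin

text \<open>
  Take \<open>\<mu>(A) = c = 1/q\<close> and build \<open>A\<close> as a limit of sets \<open>A\<^sub>s\<close> whose indicator minus \<open>c\<close> is, outside a
  set of tiny measure, a coboundary \<open>g - g \<circ> T\<close> with \<open>g\<close> bounded.  Its sums over exception-free
  orbit segments stay bounded, hence are negligible on the scale \<open>a\<^sub>n\<close> for large \<open>n\<close>.  In a Rokhlin
  tower much taller than \<open>n\<close>, overwrite a short initial piece of every block of \<open>n\<close> levels by all ones or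
  all zeros.  As \<open>a\<^sub>n/n\<close> tends to 0, this changes \<open>A\<^sub>s\<close> little, yet it shifts the sums of length \<open>n\<close> by
  \<open>a\<^sub>n t\<^sub>j\<close> on the \<open>j\<close>-th of \<open>r\<close> equal segments of the tower, so their law becomes nearly uniform on
  \<open>t\<^sub>1, \<dots>, t\<^sub>r\<close>.  A reserve at the top of the tower is used to give every column exactly the density
  \<open>c\<close>; so the new set is again a bounded coboundary off the complement of the tower, with no ergodicity
  needed.  Running through all rational lists \<open>t\<close>, with changes small compared to \<open>1/n\<close> for all earlier
  \<open>n\<close>, one set \<open>A\<close> approximates every empirical measure, and these are weakly dense.
\<close>

section \<open>Rewriting words of zeros and ones\<close>

text \<open>Any \<open>n\<close> consecutive integers contain every residue modulo \<open>n\<close>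
  once, so exactly \<open>l\<close> places carry the value \<open>v\<close>. What remains consists
  of at most two intervals, each with an \<open>f\<close>-sum of absolute value at most
  \<open>K\<close>.\<close>

lemma window_sum:
  fixes f :: "nat \<Rightarrow> real"
  assumes n: "n > 0" and l: "l \<le> n"
    and f: "\<And>i j. m \<le> i \<Longrightarrow> i \<le> j \<Longrightarrow> j \<le> m + n \<Longrightarrow> \<bar>sum f {i..<j}\<bar> \<le> K"
  shows "\<bar>(\<Sum>i\<in>{m..<m+n}. if i mod n < l then v else f i) - real l * v\<bar> \<le> 2 * K"
proof -
  define k b where "k = m div n" and "b = m mod n"
  have m: "m = k * n + b" and b: "b < n" using n by (auto simp: k_def b_def)
  \<comment> \<open>These are the untouched places: those in the block where the window starts, and
    those in the following block, which may be absent.\<close>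
  let ?I = "{max m (k*n+l)..<(k+1)*n}" and ?J = "{(k+1)*n+l..<m+n}"
  have mod: "i mod n = (if i < (k+1)*n then i - k*n else i - (k+1)*n)"
    if "i \<in> {m..<m+n}" for i
  proof (cases "i < (k+1)*n")
    case True
    have "k * n \<le> i" using that m by simp
    then obtain d where d: "i = k*n + d" by (metis le_Suc_ex)
    then have "d < n" using True by simp
    then show ?thesis using True d by simp
  next
    case False
    then obtain d where d: "i = (k+1)*n + d" by (metis le_Suc_ex not_less)
    then have "d < n" using that m b by (auto simp: algebra_simps)
    then have "((k+1)*n + d) mod n = d" by (simp only: mod_mult_self3 mod_less)
    then show ?thesis using False d by simp
  qed
  have NB: "{m..<m+n} \<inter> {i. \<not> i mod n < l} = ?I \<union> ?J"
  proof (intro set_eqI)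
    fix i
    show "i \<in> {m..<m+n} \<inter> {i. \<not> i mod n < l} \<longleftrightarrow> i \<in> ?I \<union> ?J"
    proof (cases "i \<in> {m..<m+n}")
      case True
      then show ?thesis using mod[OF True] m b l by (auto simp: algebra_simps)
    next
      case False
      then show ?thesis using m b l by (auto simp: algebra_simps)
    qed
  qed
  have disj: "?I \<inter> ?J = {}" by auto
  have cNB: "card (?I \<union> ?J) = n - l"
    by (subst card_Un_disjoint) (use disj m b l in \<open>auto simp: algebra_simps max_def\<close>)
  have "card ({m..<m+n} \<inter> {i. i mod n < l}) + card ({m..<m+n} \<inter> {i. \<not> i mod n < l}) = n"
    by (subst card_Un_disjoint[symmetric]) (auto simp: Int_Un_distrib[symmetric] Collect_disj_eq[symmetric])
  then have cB: "card ({m..<m+n} \<inter> {i. i mod n < l}) = l"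
    using cNB NB l by simp
  have "(\<Sum>i\<in>{m..<m+n}. if i mod n < l then v else f i)
      = real l * v + sum f (?I \<union> ?J)"
    by (subst sum.If_cases) (use NB cB in \<open>auto simp: Collect_neg_eq\<close>)
  also have "sum f (?I \<union> ?J) = sum f ?I + sum f ?J"
    by (rule sum.union_disjoint) (use disj in auto)
  finally have eq: "(\<Sum>i\<in>{m..<m+n}. if i mod n < l then v else f i) - real l * v = sum f ?I + sum f ?J"
    by simp
  have "\<bar>sum f ?I\<bar> \<le> K"
    by (rule f) (use m b l in \<open>auto simp: algebra_simps\<close>)
  moreover have "\<bar>sum f ?J\<bar> \<le> K"
  proof (cases "(k+1)*n+l \<le> m + n")
    case True
    then show ?thesis using f[of "(k+1)*n+l" "m+n"] m b by (auto simp: algebra_simps)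
  next
    case False
    \<comment> \<open>\<open>?J\<close> is empty here; the empty interval \<open>{m..<m}\<close>
      yields 0 <= \<open>K\<close>.\<close>
    then show ?thesis using f[of m m] by simp
  qed
  ultimately show ?thesis unfolding eq by linarith
qed

text \<open>Division with remainder puts these positions in bijection with the pairs of a block
  number below \<open>N\<close> and a remainder below \<open>x\<close>.\<close>

lemma card_mod_less:
  fixes n N x :: nat
  assumes "x \<le> n"
  shows "card {i. i < N * n \<and> i mod n < x} = N * x"
proof -
  let ?f = "\<lambda>(k, b). k * n + b"
  have "{i. i < N * n \<and> i mod n < x} = ?f ` ({..<N} \<times> {..<x})"
  proof (intro equalityI subsetI)
    fix i assume "i \<in> {i. i < N * n \<and> i mod n < x}"
    then have "i = ?f (i div n, i mod n)" "i div n < N" "i mod n < x"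
      by (auto simp: less_mult_imp_div_less)
    then show "i \<in> ?f ` ({..<N} \<times> {..<x})" by blast
  next
    fix i assume "i \<in> ?f ` ({..<N} \<times> {..<x})"
    then obtain k b where kb: "i = k * n + b" "k < N" "b < x" by auto
    have "k * n + b < Suc k * n" using kb assms by simp
    also have "\<dots> \<le> N * n" using kb by (intro mult_right_mono) auto
    finally show "i \<in> {i. i < N * n \<and> i mod n < x}" using kb assms by auto
  qed
  moreover have "inj_on ?f ({..<N} \<times> {..<x})"
  proof (rule inj_onI, clarify)
    fix k b k' b' assume *: "b < x" "b' < x" "k * n + b = k' * n + b'"
    have "b < n" "b' < n" using * assms by auto
    then have "(k * n + b) div n = k" "(k' * n + b') div n = k'"
      "(k * n + b) mod n = b" "(k' * n + b') mod n = b'" by simp_all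
    then show "k = k' \<and> b = b'" using * by metis
  qed
  ultimately show ?thesis by (simp add: card_image)
qed

lemma sum_indicator_card:
  "finite I \<Longrightarrow> (\<Sum>i\<in>I. indicator D i :: real) = real (card (I \<inter> D))"
  by (simp add: indicator_def sum.If_cases Int_def)

lemma sum_indicator_diff:
  fixes c :: real
  assumes "finite I" and eq: "V - D = W - D"
  shows "\<bar>(\<Sum>i\<in>I. indicator V i - c) - (\<Sum>i\<in>I. indicator W i - c)\<bar> \<le> real (card (I \<inter> D))"
proof -
  have "\<bar>(\<Sum>i\<in>I. indicator V i - c) - (\<Sum>i\<in>I. indicator W i - c)\<bar>
      = \<bar>\<Sum>i\<in>I. indicator V i - (indicator W i :: real)\<bar>"
    by (simp add: sum_subtractf)
  also have "\<dots> \<le> (\<Sum>i\<in>I. \<bar>indicator V i - (indicator W i :: real)\<bar>)" by (rule sum_abs)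
  also have "\<dots> \<le> (\<Sum>i\<in>I. indicator D i)"
    using eq by (intro sum_mono) (auto simp: indicator_def set_eq_iff)
  also have "\<dots> = real (card (I \<inter> D))"
    using \<open>finite I\<close> by (simp add: sum_indicator_card)
  finally show ?thesis .
qed

text \<open>
  Positions below \<open>length t * L\<close> form the segments, \<open>D\<close> consists of the overwritten block pieces and
  of the reserve up to \<open>H\<close>.
\<close>

lemma word_surgery:
  fixes t :: "real list" and a :: "nat \<Rightarrow> real" and q :: nat and K \<gamma> \<kappa> :: real
  assumes q: "q \<ge> 2" and K: "K \<ge> 0" and t: "t \<noteq> []" and \<gamma>: "\<gamma> > 0" and \<kappa>: "\<kappa> > 0"
    and a: "\<And>n. a n > 0" and a_top: "filterlim a at_top sequentially"
    and a_n: "(\<lambda>n. a n / real n) \<longlonglongrightarrow> 0"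
  obtains n H L :: nat and D :: "nat set" where
    "n > 0" "H > 0" "q dvd H" "n \<le> L" "length t * L \<le> H"
    "real (length t) * (real L - real n) \<ge> (1 - \<gamma>) * real H"
    "D \<subseteq> {..<H}" "real (card D) \<le> \<kappa> * real H"
    "\<forall>W. (\<forall>i j. i \<le> j \<longrightarrow> j \<le> H \<longrightarrow> \<bar>\<Sum>k\<in>{i..<j}. indicator W k - 1 / real q\<bar> \<le> K) \<longrightarrow>
      (\<exists>W'. (\<Sum>k<H. indicator W' k - 1 / real q) = 0 \<and> W' \<inter> {..<H} - D = W \<inter> {..<H} - D \<and>
        (\<forall>j<length t. \<forall>m. j * L \<le> m \<longrightarrow> m + n \<le> Suc j * L \<longrightarrow>
          \<bar>(\<Sum>k\<in>{m..<m+n}. indicator W' k - 1 / real q) - a n * t ! j\<bar> \<le> \<gamma> * a n))"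
proof -
  \<comment> \<open>Each overwritten letter will contribute at least 1 / \<open>q\<close> in
    absolute value, so a shift by \<open>a n * t ! j\<close> takes at most \<open>a n * C\<close>
    letters.\<close>
  define C where "C = (\<Sum>s\<leftarrow>t. \<bar>s\<bar>) * real q"
  have C: "\<bar>t ! j\<bar> * real q \<le> C" if "j < length t" for j
    unfolding C_def using that
    by (intro mult_right_mono member_le_sum_list) (auto intro: nth_mem)
  have C0: "C \<ge> 0" unfolding C_def by (intro mult_nonneg_nonneg sum_list_nonneg) auto
  define \<theta> where "\<theta> = min (\<gamma>/2) (\<kappa>/2)"
  have \<theta>: "\<theta> > 0" "\<theta> \<le> \<gamma>/2" "\<theta> \<le> \<kappa>/2" using \<gamma> \<kappa> by (auto simp: \<theta>_def)
  have "eventually (\<lambda>n. a n \<ge> (2 * K + 1) / \<gamma>) sequentially"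
    using a_top by (auto simp: filterlim_at_top)
  moreover have "eventually (\<lambda>n. a n / real n * (q * C) + (q * (K + 1)) / real n < min \<theta> 1) sequentially"
  proof -
    have "(\<lambda>n. a n / real n * (q * C) + (q * (K + 1)) / real n) \<longlonglongrightarrow> 0 * (q * C) + 0"
      by (intro tendsto_intros a_n lim_const_over_n)
    then show ?thesis using \<theta> by (intro order_tendstoD(2)) auto
  qed
  moreover have "eventually (\<lambda>n. n > (0::nat)) sequentially" by (rule eventually_gt_at_top)
  \<comment> \<open>The first condition absorbs the error \<open>2 * K + 1\<close> of window sums
    into \<open>\<gamma> * a n\<close>; the second makes \<open>q * x\<close> small compared to
    \<open>n\<close> for the \<open>x\<close> chosen next.\<close>
  ultimately have "eventually (\<lambda>n. a n \<ge> (2 * K + 1) / \<gamma> \<and>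
     a n / real n * (q * C) + (q * (K + 1)) / real n < min \<theta> 1 \<and> n > 0) sequentially"
    by eventually_elim auto
  then obtain n where n1: "a n \<ge> (2 * K + 1) / \<gamma>"
    and n2: "a n / real n * (q * C) + (q * (K + 1)) / real n < min \<theta> 1" and n0: "n > 0"
    by (auto dest: eventually_happens)
  \<comment> \<open>\<open>x\<close> bounds the letters overwritten per block and leaves a surplus
    \<open>K\<close>, which later pays for the imbalance of the old word.\<close>
  define x where "x = nat \<lceil>K + a n * C\<rceil>"
  have x1: "real x \<ge> K + a n * C" unfolding x_def by linarith
  have x2: "real x \<le> K + a n * C + 1" unfolding x_def
    using K C0 a[of n] by (smt (verit, best) mult_nonneg_nonneg of_int_ceiling_le_add_one of_nat_nat ceiling_mono ceiling_zero)
  have "real q * real x \<le> q * (K + a n * C + 1)" using x2 by (intro mult_left_mono) auto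
  also have "\<dots> = (a n / real n * (q * C) + (q * (K + 1)) / real n) * n"
    using n0 by (simp add: field_simps)
  finally have "real q * real x < min \<theta> 1 * n" using n2 n0
    by (meson less_le_trans mult_strict_right_mono of_nat_0_less_iff order_le_less_trans)
  moreover have "min \<theta> 1 * real n \<le> \<theta> * real n" "min \<theta> 1 * real n \<le> 1 * real n"
    by (intro mult_right_mono; simp)+
  ultimately have qx: "real q * real x \<le> \<theta> * n" "real q * real x < n" by linarith+
  have "real x \<le> real q * real x" using q mult_right_mono[of 1 "real q" "real x"] by auto
  then have xn: "x \<le> n" using qx(2) by linarith
  \<comment> \<open>A segment will have at least 2 / \<gamma> blocks, so the starting places too
    close to a segment end to leave room for a window take up at most the fraction \<gamma> / 2 of
    the segments.\<close>
  define p' where "p' = nat \<lceil>2 / \<gamma>\<rceil>"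
  have p': "p' \<ge> 2 / \<gamma>" unfolding p'_def by linarith
  have p'0: "p' > 0" using p' \<gamma> by (metis divide_pos_pos gr0I le_numeral_extra(3) not_le of_nat_0 order.strict_trans2 zero_less_numeral)
  define p where "p = q * p'"
  define r where "r = length t"
  have r: "r > 0" using t by (simp add: r_def)
  define L where "L = p * n"
  define N where "N = r * p"
  \<comment> \<open>The last \<open>q * N * x\<close> places are the reserve. Its balanced share of
    ones is \<open>N * x\<close>, which also bounds the surplus or deficit of the rest; hence at
    most \<open>2 * N * x\<close> ones are needed there, and these fit because \<open>q\<close> >=
    2.\<close>
  define H where "H = N * n + q * N * x"
  have N0: "N > 0" using r q p'0 by (simp add: N_def p_def)
  have rL: "r * L = N * n" by (simp add: L_def N_def)
  have L0: "L > 0" using n0 q p'0 by (simp add: L_def p_def)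
  define D where "D = {i. i < N * n \<and> i mod n < x} \<union> {N*n..<H}"
  show ?thesis
  proof (rule that[of n H L D])
    show "n > 0" by fact
    show "H > 0" using N0 n0 by (simp add: H_def)
    show "q dvd H" by (auto simp: H_def N_def p_def intro!: dvd_add)
    show "n \<le> L" using q p'0 by (simp add: L_def p_def)
    show "length t * L \<le> H" using rL by (simp add: H_def r_def)
    show "(1 - \<gamma>) * real H \<le> real (length t) * (real L - real n)"
    proof -
      have "p \<ge> p'" using q by (simp add: p_def)
      then have "real p \<ge> 2/\<gamma>" using p' by linarith
      then have "real p * \<gamma> \<ge> 2" using \<gamma> by (simp add: field_simps)
      then have "real r * n * (real p * \<gamma>) \<ge> real r * n * 2" by (intro mult_left_mono) auto
      then have 1: "real r * n \<le> \<gamma>/2 * (N * n)" by (simp add: N_def field_simps)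
      have "q * real x \<le> \<gamma> /2 * n" using qx(1) \<theta>(2) mult_right_mono[of \<theta> "\<gamma>/2" "real n"] by linarith
      then have "real N * (q * real x) \<le> real N * (\<gamma> /2 * n)" by (intro mult_left_mono) auto
      moreover have "real H * \<gamma> \<ge> N * n * \<gamma>" using \<gamma> by (intro mult_right_mono) (auto simp: H_def)
      moreover have "real r * real L = N * n" using rL by (metis of_nat_mult)
      ultimately show ?thesis using 1 by (simp add: H_def r_def[symmetric] algebra_simps)
    qed
    show "D \<subseteq> {..<H}" by (auto simp: D_def H_def)
    show "real (card D) \<le> \<kappa> * real H"
    proof -
      have "card D \<le> N * x + q * N * x"
        unfolding D_def using card_mod_less[OF xn, of N]
        by (intro order_trans[OF card_Un_le]) (auto simp: H_def)
      also have "\<dots> \<le> 2 * (q * N * x)" using q by auto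
      finally have "real (card D) \<le> 2 * (N * (q * real x))" by (metis mult.assoc mult.left_commute of_nat_le_iff of_nat_mult of_nat_numeral)
      also have "\<dots> \<le> 2 * (N * (\<theta> * n))" using qx(1) by (intro mult_left_mono) auto
      also have "\<dots> \<le> 2 * (N * (\<kappa>/2 * n))" using \<theta>(3) by (intro mult_left_mono mult_right_mono) auto
      also have "\<dots> \<le> \<kappa> * real H" using \<kappa> by (simp add: H_def algebra_simps)
      finally show ?thesis .
    qed
  next
    show "\<forall>W. (\<forall>i j. i \<le> j \<longrightarrow> j \<le> H \<longrightarrow> \<bar>\<Sum>k\<in>{i..<j}. indicator W k - 1 / real q\<bar> \<le> K) \<longrightarrow>
      (\<exists>W'. (\<Sum>k<H. indicator W' k - 1 / real q) = 0 \<and> W' \<inter> {..<H} - D = W \<inter> {..<H} - D \<and>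
        (\<forall>j<length t. \<forall>m. j * L \<le> m \<longrightarrow> m + n \<le> Suc j * L \<longrightarrow>
          \<bar>(\<Sum>k\<in>{m..<m+n}. indicator W' k - 1 / real q) - a n * t ! j\<bar> \<le> \<gamma> * a n))"
    proof (intro allI impI)
      fix W :: "nat set"
      assume "\<forall>i j. i \<le> j \<longrightarrow> j \<le> H \<longrightarrow> \<bar>\<Sum>k\<in>{i..<j}. indicator W k - 1 / real q\<bar> \<le> K"
      then have W: "\<And>i j. i \<le> j \<Longrightarrow> j \<le> H \<Longrightarrow> \<bar>\<Sum>k\<in>{i..<j}. indicator W k - 1 / real q\<bar> \<le> K"
        by blast
      \<comment> \<open>To raise a sum, ones are written, each worth 1 - 1 / \<open>q\<close>; to
        lower it, zeros, each worth -1 / \<open>q\<close>. Rounding the number \<open>l j\<close> of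
        letters down costs at most 1 in the sum.\<close>
      define pos where "pos j \<longleftrightarrow> t ! j \<ge> 0" for j
      define v where "v j = (if pos j then 1 else 0) - 1 / real q" for j
      define l where "l j = nat \<lfloor>a n * t ! j / v j\<rfloor>" for j
      have v: "\<bar>v j\<bar> \<le> 1" "\<bar>v j\<bar> \<ge> 1 / q" "t ! j / v j \<ge> 0" "v j \<noteq> 0" for j
      proof -
        have "1 / real q \<le> 1/2" "1 / real q > 0" using q by (auto simp: field_simps)
        then show "\<bar>v j\<bar> \<le> 1" "\<bar>v j\<bar> \<ge> 1 / q" "v j \<noteq> 0" "t ! j / v j \<ge> 0"
          unfolding v_def pos_def by (auto simp: zero_le_divide_iff)
      qed
      have nn: "a n * t ! j / v j \<ge> 0" for j
        using v(3)[of j] a[of n] by (simp add: less_imp_le flip: times_divide_eq_right)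
      have l1: "\<bar>real (l j) * v j - a n * t ! j\<bar> \<le> 1" for j
      proof -
        have "\<bar>real (l j) - a n * t ! j / v j\<bar> \<le> 1" unfolding l_def using nn[of j] by linarith
        then have "\<bar>real (l j) - a n * t ! j / v j\<bar> * \<bar>v j\<bar> \<le> 1 * 1"
          using v(1) by (intro mult_mono) auto
        moreover have "(real (l j) - a n * t ! j / v j) * v j = real (l j) * v j - a n * t ! j"
          using v(4)[of j] by (simp add: algebra_simps)
        ultimately show ?thesis by (simp add: abs_mult[symmetric])
      qed
      define lm where "lm = nat \<lfloor>a n * C\<rfloor>"
      have lm: "l j \<le> lm" if "j < r" for j
      proof -
        have "\<bar>t ! j\<bar> / \<bar>v j\<bar> \<le> \<bar>t ! j\<bar> / (1/q)" using v(2)[of j] v(4)[of j] q by (intro divide_left_mono mult_pos_pos) auto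
        also have "\<dots> \<le> C" using C[of j] that by (simp add: r_def)
        finally have "t ! j / v j \<le> C" using v(3)[of j] by (simp flip: abs_divide)
        then have "a n * (t ! j / v j) \<le> a n * C" using a[of n] by (intro mult_left_mono) auto
        then show ?thesis unfolding l_def lm_def by (intro nat_mono floor_mono) simp
      qed
      have "a n * C \<ge> 0" using a[of n] C0 by simp
      then have lmx: "K + real lm \<le> x" using x1 unfolding lm_def by linarith
      then have "lm \<le> x" using K by linarith
      then have l2: "l j \<le> x" if "j < r" for j using lm[OF that] by simp
      define V where "V = {i. i < N * n \<and> (if i mod n < l (i div L) then pos (i div L) else i \<in> W)}"
      define Z where "Z = card V"
      have divr: "i div L < r" if "i < N * n" for i using that rL by (metis less_mult_imp_div_less)
      have VD: "V - D = W \<inter> {..<N*n} - D"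
      proof (intro set_eqI)
        fix i
        show "i \<in> V - D \<longleftrightarrow> i \<in> W \<inter> {..<N*n} - D"
        proof (cases "i < N * n \<and> \<not> i mod n < x")
          case True
          then have "\<not> i mod n < l (i div L)" using l2[OF divr, of i] by linarith
          then show ?thesis using True by (auto simp: V_def)
        next
          case False
          then show ?thesis by (auto simp: V_def D_def)
        qed
      qed
      have sumV: "(\<Sum>k<N*n. indicator V k - 1 / real q) = real Z - real N * n / q"
      proof -
        have "{..<N*n} \<inter> V = V" by (auto simp: V_def)
        then show ?thesis by (simp add: sum_subtractf sum_indicator_card Z_def)
      qed
      \<comment> \<open>Only the overwritten places, at most \<open>lm\<close> per block, and the
        imbalance \<open>K\<close> of the old word contribute, and \<open>K + lm\<close> is at most
        \<open>x\<close>.\<close>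
      have Zb: "\<bar>real Z - real N * n / q\<bar> \<le> real N * x"
      proof -
        let ?D = "{i. i < N * n \<and> i mod n < lm}"
        have "lm \<le> n" using \<open>lm \<le> x\<close> xn by linarith
        have "V - ?D = W \<inter> {..<N*n} - ?D"
        proof (intro set_eqI)
          fix i
          show "i \<in> V - ?D \<longleftrightarrow> i \<in> W \<inter> {..<N*n} - ?D"
          proof (cases "i < N * n \<and> \<not> i mod n < lm")
            case True
            then have "\<not> i mod n < l (i div L)" using lm[OF divr, of i] by linarith
            then show ?thesis using True by (auto simp: V_def)
          next
            case False
            then show ?thesis by (auto simp: V_def)
          qed
        qed
        from sum_indicator_diff[OF _ this, of "{..<N*n}" "1/q"]
        have "\<bar>(\<Sum>i<N*n. indicator V i - 1/q) - (\<Sum>i<N*n. indicator (W \<inter> {..<N*n}) i - 1/q)\<bar>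
          \<le> real (card ({..<N*n} \<inter> ?D))" by simp
        also have "\<dots> \<le> real (N * lm)"
          using card_mod_less[OF \<open>lm \<le> n\<close>, of N]
          by (intro of_nat_mono) (simp add: Int_def conj_commute lessThan_def)
        finally have "\<bar>(\<Sum>i<N*n. indicator V i - 1/q) - (\<Sum>i<N*n. indicator (W \<inter> {..<N*n}) i - 1/q)\<bar> \<le> real N * real lm" by simp
        moreover have "(\<Sum>i<N*n. indicator (W \<inter> {..<N*n}) i - 1/q) = (\<Sum>i\<in>{0..<N*n}. indicator W i - 1/real q)"
          by (intro sum.cong) (auto simp: indicator_def)
        moreover have "\<bar>\<Sum>i\<in>{0..<N*n}. indicator W i - 1/real q\<bar> \<le> K" by (rule W) (auto simp: H_def)
        ultimately have "\<bar>real Z - real N * n / q\<bar> \<le> K + real N * real lm" using sumV by linarith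
        also have "\<dots> \<le> real N * (K + real lm)"
          using N0 K mult_right_mono[of 1 "real N" K] by (auto simp: algebra_simps)
        also have "\<dots> \<le> real N * x" using lmx by (intro mult_left_mono) auto
        finally show ?thesis .
      qed
      \<comment> \<open>Since \<open>q\<close> divides \<open>N\<close>, the balanced number of ones
        on the segments is the integer \<open>N' * n\<close>.\<close>
      define N' where "N' = r * p'"
      have N': "N = q * N'" by (simp add: N_def N'_def p_def)
      have Nn: "real N * n / q = real (N' * n)" using q by (simp add: N')
      \<comment> \<open>\<open>u\<close> ones in the reserve bring the total number of ones to
        exactly \<open>H\<close> / \<open>q\<close>.\<close>
      define u where "u = nat (int (N' * n + N * x) - int Z)"
      have u: "real u = real (N' * n) + real (N * x) - real Z" "u \<le> q * N * x"
      proof -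
        have "Z \<le> N' * n + N * x" using Zb unfolding Nn by (simp add: abs_le_iff flip: of_nat_mult of_nat_add)
        then show "real u = real (N' * n) + real (N * x) - real Z" by (simp add: u_def flip: of_nat_add of_nat_mult)
        then have "real u \<le> real (2 * N * x)" using Zb unfolding Nn by (simp add: abs_le_iff)
        then have "u \<le> 2 * N * x" by linarith
        also have "\<dots> \<le> q * N * x" using q by simp
        finally show "u \<le> q * N * x" .
      qed
      define W' where "W' = V \<union> {N*n..<N*n+u}"
      have W'V: "k \<in> W' \<longleftrightarrow> k \<in> V" if "k < N * n" for k using that by (auto simp: W'_def)
      show "\<exists>W'. (\<Sum>k<H. indicator W' k - 1 / real q) = 0 \<and> W' \<inter> {..<H} - D = W \<inter> {..<H} - D \<and>
          (\<forall>j<length t. \<forall>m. j * L \<le> m \<longrightarrow> m + n \<le> Suc j * L \<longrightarrow>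
            \<bar>(\<Sum>k\<in>{m..<m+n}. indicator W' k - 1 / real q) - a n * t ! j\<bar> \<le> \<gamma> * a n)"
      proof (intro exI[of _ W'] conjI allI impI)
        have "W' \<inter> {..<H} = W'" "{..<H} \<inter> W' = W'" using u(2) by (auto simp: W'_def V_def H_def)
        moreover have "card W' = Z + u" unfolding W'_def Z_def
          by (subst card_Un_disjoint) (auto simp: V_def)
        ultimately have "(\<Sum>k<H. indicator W' k - 1 / real q) = real Z + real u - real H / q"
          by (simp add: sum_subtractf sum_indicator_card)
        also have "\<dots> = 0" using u(1) q by (simp add: H_def N' field_simps)
        finally show "(\<Sum>k<H. indicator W' k - 1 / real q) = 0" .
        have "k \<in> W' - D \<longleftrightarrow> k \<in> W \<inter> {..<H} - D" for k
        proof (cases "k < N * n")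
          case True
          then show ?thesis using VD W'V[OF True] by (auto simp: set_eq_iff H_def)
        next
          case False
          then show ?thesis using u(2) by (auto simp: W'_def V_def D_def H_def)
        qed
        then show "W' \<inter> {..<H} - D = W \<inter> {..<H} - D"
          using \<open>W' \<inter> {..<H} = W'\<close> by blast
      next
        fix j m assume j: "j < length t" and m1: "j * L \<le> m" and m2: "m + n \<le> Suc j * L"
        have "Suc j * L \<le> r * L" using j by (intro mult_right_mono) (auto simp: r_def)
        then have mN: "m + n \<le> N * n" using m2 rL by linarith
        have "(\<Sum>k\<in>{m..<m+n}. indicator W' k - 1 / real q) =
          (\<Sum>i\<in>{m..<m+n}. if i mod n < l j then v j else indicator W i - 1 / real q)"
        proof (intro sum.cong refl)
          fix i assume i: "i \<in> {m..<m+n}"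
          then have "i < N * n" using mN by auto
          moreover have "i div L = j"
            using i m1 m2 by (intro div_nat_eqI) (auto simp: mult.commute)
          ultimately show "indicator W' i - 1 / real q = (if i mod n < l j then v j else indicator W i - 1 / real q)"
            using W'V[of i] by (auto simp: V_def v_def indicator_def)
        qed
        moreover have "\<bar>(\<Sum>i\<in>{m..<m+n}. if i mod n < l j then v j else indicator W i - 1 / real q) - real (l j) * v j\<bar> \<le> 2 * K"
          using j l2[of j] xn mN by (intro window_sum n0 W) (auto simp: r_def H_def)
        ultimately have "\<bar>(\<Sum>k\<in>{m..<m+n}. indicator W' k - 1 / real q) - a n * t ! j\<bar> \<le> 2 * K + 1"
          using l1[of j] by linarith
        also have "\<dots> \<le> \<gamma> * a n" using n1 \<gamma> by (simp add: field_simps)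
        finally show "\<bar>(\<Sum>k\<in>{m..<m+n}. indicator W' k - 1 / real q) - a n * t ! j\<bar> \<le> \<gamma> * a n" .
      qed
    qed
  qed
qed

section \<open>Rokhlin towers for aperiodic systems\<close>

lemma (in finite_measure) measure_UN_le:
  assumes "finite I" "\<And>i. i \<in> I \<Longrightarrow> F i \<in> sets M" "\<And>i. i \<in> I \<Longrightarrow> measure M (F i) \<le> b"
  shows "measure M (\<Union>i\<in>I. F i) \<le> real (card I) * b"
proof -
  have "measure M (\<Union>i\<in>I. F i) \<le> (\<Sum>i\<in>I. measure M (F i))"
    using assms by (intro finite_measure_subadditive_finite) auto
  also have "\<dots> \<le> (\<Sum>i\<in>I. b)" using assms by (intro sum_mono) auto
  finally show ?thesis by simp
qed

section \<open>Invertible measure preserving maps and their iterates\<close>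

locale mp_system = prob_space M for M :: "'a measure" +
  fixes T S :: "'a \<Rightarrow> 'a"
  assumes T_meas [measurable]: "T \<in> measurable M M" and S_meas [measurable]: "S \<in> measurable M M"
    and S_T: "x \<in> space M \<Longrightarrow> S (T x) = x" and T_S: "x \<in> space M \<Longrightarrow> T (S x) = x"
    and distr_T: "distr M M T = M"
begin

lemma funpow_T_meas [measurable]: "(T ^^ n) \<in> measurable M M"
  by (induction n) (auto intro: measurable_comp[OF _ T_meas])

lemma funpow_S_meas [measurable]: "(S ^^ n) \<in> measurable M M"
  by (induction n) (auto intro: measurable_comp[OF _ S_meas])

lemma T_space: "x \<in> space M \<Longrightarrow> T x \<in> space M"
  using T_meas by (rule measurable_space)

lemma funpow_T_space: "x \<in> space M \<Longrightarrow> (T ^^ n) x \<in> space M"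
  using funpow_T_meas by (rule measurable_space)

lemma funpow_S_space: "x \<in> space M \<Longrightarrow> (S ^^ n) x \<in> space M"
  using funpow_S_meas by (rule measurable_space)

lemma funpow_S_T_same: "x \<in> space M \<Longrightarrow> (S ^^ n) ((T ^^ n) x) = x"
proof (induction n)
  case (Suc n)
  have "(S ^^ Suc n) ((T ^^ Suc n) x) = (S ^^ n) (S (T ((T ^^ n) x)))"
    by (simp only: funpow_Suc_right[of n S] funpow.simps(2)[of n T] comp_apply)
  then show ?case using Suc by (simp add: S_T funpow_T_space)
qed simp

lemma funpow_T_S_same: "x \<in> space M \<Longrightarrow> (T ^^ n) ((S ^^ n) x) = x"
proof (induction n)
  case (Suc n)
  have "(T ^^ Suc n) ((S ^^ Suc n) x) = (T ^^ n) (T (S ((S ^^ n) x)))"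
    by (simp only: funpow_Suc_right[of n T] funpow.simps(2)[of n S] comp_apply)
  then show ?case using Suc by (simp add: T_S funpow_S_space)
qed simp

lemma funpow_T_S: "x \<in> space M \<Longrightarrow> k \<le> n \<Longrightarrow> (T ^^ k) ((S ^^ n) x) = (S ^^ (n - k)) x"
proof -
  assume x: "x \<in> space M" and k: "k \<le> n"
  have "(T ^^ k) ((S ^^ (k + (n - k))) x) = (S ^^ (n - k)) x"
    unfolding funpow_add comp_apply using x by (simp add: funpow_T_S_same funpow_S_space)
  then show ?thesis using k by simp
qed

lemma funpow_T_S': "x \<in> space M \<Longrightarrow> k \<le> n \<Longrightarrow> (T ^^ n) ((S ^^ k) x) = (T ^^ (n - k)) x"
proof -
  assume x: "x \<in> space M" and k: "k \<le> n"
  have "(T ^^ (n - k + k)) ((S ^^ k) x) = (T ^^ (n - k)) x"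
    unfolding funpow_add comp_apply funpow_T_S_same[OF x] ..
  then show ?thesis using k by simp
qed

lemma distr_funpow_T: "distr M M (T ^^ n) = M"
proof (induction n)
  case (Suc n)
  have "distr M M (T ^^ Suc n) = distr (distr M M (T ^^ n)) M T"
    by (subst distr_distr) auto
  then show ?case by (simp only: Suc distr_T)
qed (simp add: id_def distr_id)

text \<open>Push the invariant law of \<open>T ^^ n\<close> forward by \<open>S ^^ n\<close> and
  cancel.\<close>

lemma distr_funpow_S: "distr M M (S ^^ n) = M"
proof -
  have "distr M M (S ^^ n) = distr (distr M M (T ^^ n)) M (S ^^ n)"
    by (simp add: distr_funpow_T)
  also have "\<dots> = distr M M (\<lambda>x. (S ^^ n) ((T ^^ n) x))" by (simp add: distr_distr comp_def)
  also have "\<dots> = distr M M (\<lambda>x. x)" by (rule distr_cong) (auto simp: funpow_S_T_same)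
  finally show ?thesis by (simp add: distr_id)
qed

lemma measure_T:
  assumes [measurable]: "A \<in> sets M"
  shows "measure M {x \<in> space M. (T ^^ n) x \<in> A} = measure M A"
proof -
  have "measure M A = measure (distr M M (T ^^ n)) A" by (simp add: distr_funpow_T)
  also have "\<dots> = measure M ((T ^^ n) -` A \<inter> space M)"
    by (rule measure_distr) measurable
  also have "(T ^^ n) -` A \<inter> space M = {x \<in> space M. (T ^^ n) x \<in> A}" by auto
  finally show ?thesis by simp
qed

lemma measure_S:
  assumes [measurable]: "A \<in> sets M"
  shows "measure M {x \<in> space M. (S ^^ n) x \<in> A} = measure M A"
proof -
  have "measure M A = measure (distr M M (S ^^ n)) A" by (simp add: distr_funpow_S)
  also have "\<dots> = measure M ((S ^^ n) -` A \<inter> space M)"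
    by (rule measure_distr) measurable
  also have "(S ^^ n) -` A \<inter> space M = {x \<in> space M. (S ^^ n) x \<in> A}" by auto
  finally show ?thesis by simp
qed

definition free_set :: "nat \<Rightarrow> 'a set \<Rightarrow> bool" where
  "free_set N B \<longleftrightarrow> B \<in> sets M \<and> (\<forall>x\<in>B. \<forall>i. 1 \<le> i \<longrightarrow> i < N \<longrightarrow> (T ^^ i) x \<notin> B)"

text \<open>The preimages of \<open>B\<close> under \<open>T ^^ i\<close> for \<open>i\<close> <
  \<open>N\<close> are pairwise disjoint, because two hits would be a return within fewer than
  \<open>N\<close> steps; they all have the measure of \<open>B\<close>.\<close>

lemma free_set_measure:
  assumes "free_set N B"
  shows "real N * measure M B \<le> 1"
proof -
  have B [measurable]: "B \<in> sets M" using assms by (simp add: free_set_def)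
  let ?F = "\<lambda>i. {x \<in> space M. (T ^^ i) x \<in> B}"
  have "disjoint_family_on ?F {..<N}"
  proof -
    have F: False if "i < j" "j < N" "(T ^^ i) x \<in> B" "(T ^^ j) x \<in> B" for i j x
    proof -
      have "(T ^^ (j - i)) ((T ^^ i) x) = (T ^^ j) x"
        using that by (simp flip: funpow_add[THEN fun_cong, unfolded comp_apply])
      moreover have "1 \<le> j - i" "j - i < N" using that by auto
      ultimately show False using assms that unfolding free_set_def by metis
    qed
    show ?thesis unfolding disjoint_family_on_def
    proof (intro ballI impI)
      fix i j assume "i \<in> {..<N}" "j \<in> {..<N}" "i \<noteq> j"
      then show "?F i \<inter> ?F j = {}" using F[of i j] F[of j i] by (cases "i < j") auto
    qed
  qed
  then have "measure M (\<Union>i\<in>{..<N}. ?F i) = (\<Sum>i<N. measure M (?F i))"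
    by (intro finite_measure_finite_Union) auto
  also have "\<dots> = real N * measure M B" by (simp add: measure_T)
  finally have "real N * measure M B = measure M (\<Union>i\<in>{..<N}. ?F i)" by simp
  also have "\<dots> \<le> 1" by (rule prob_le_1)
  finally show ?thesis .
qed

text \<open>Greedily add those points of \<open>W j\<close> that have no earlier marker within distance \<open>N\<close>.\<close>

lemma marker_set:
  fixes W :: "nat \<Rightarrow> 'a set"
  assumes W: "\<And>j. free_set N (W j)"
  obtains B where "free_set N B"
    "\<And>x j. x \<in> W j \<Longrightarrow> \<exists>i<Suc N. (T ^^ i) x \<in> B \<or> (S ^^ i) x \<in> B"
proof -
  define step where "step j B = B \<union> {x \<in> W j. \<forall>i<N. (T ^^ i) x \<notin> B \<and> (S ^^ i) x \<notin> B}" for j B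
  define B where "B = rec_nat {} step"
  have B0: "B 0 = {}" and BS: "B (Suc j) = step j (B j)" for j by (auto simp: B_def)
  have free: "free_set N (B j)" for j
  proof (induction j)
    case 0 then show ?case by (simp add: B0 free_set_def)
  next
    case (Suc j)
    have [measurable]: "B j \<in> sets M" "W j \<in> sets M" using Suc W by (auto simp: free_set_def)
    have "{x \<in> W j. \<forall>i<N. (T ^^ i) x \<notin> B j \<and> (S ^^ i) x \<notin> B j}
        = {x \<in> space M. x \<in> W j \<and> (\<forall>i<N. (T ^^ i) x \<notin> B j \<and> (S ^^ i) x \<notin> B j)}"
      using sets.sets_into_space[of "W j" M] by auto
    also have "\<dots> \<in> sets M" by measurable
    finally have "B (Suc j) \<in> sets M" by (simp add: BS step_def)
    moreover have False if x: "x \<in> B (Suc j)" and i: "1 \<le> i" "i < N" and Tx: "(T ^^ i) x \<in> B (Suc j)" for x i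
    proof -
      have sp: "x \<in> space M" using x \<open>B (Suc j) \<in> sets M\<close> sets.sets_into_space by auto
      show False
      proof (cases "x \<in> B j")
        case True
        then have "(T ^^ i) x \<notin> B j" using Suc i by (auto simp: free_set_def)
        \<comment> \<open>Being outside \<open>B j\<close>, the point \<open>(T ^^ i) x\<close> must
          be newly added, which requires that no old marker lie \<open>i\<close> steps behind it;
          but \<open>x\<close> is one.\<close>
        then have "(S ^^ i) ((T ^^ i) x) \<notin> B j" using Tx i by (auto simp: BS step_def)
        then show False using True sp by (simp add: funpow_S_T_same)
      next
        case False
        then have x': "x \<in> W j" "(T ^^ i) x \<notin> B j" using x i by (auto simp: BS step_def)
        \<comment> \<open>Two new points at distance \<open>i\<close> both lie in
          \<open>W j\<close>, which is itself free.\<close>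
        then have "(T ^^ i) x \<in> W j" using Tx by (auto simp: BS step_def)
        then show False using x' W[of j] i by (auto simp: free_set_def)
      qed
    qed
    ultimately show ?case by (auto simp: free_set_def)
  qed
  have mono: "incseq B" by (rule incseq_SucI) (auto simp: BS step_def)
  show ?thesis
  proof (rule that[of "\<Union>j. B j"])
    have "(\<Union>j. B j) \<in> sets M" using free by (auto simp: free_set_def)
    moreover have False if "x \<in> B j" "(T ^^ i) x \<in> B k" "1 \<le> i" "i < N" for x i j k
    proof -
      have "B j \<subseteq> B (max j k)" "B k \<subseteq> B (max j k)"
        using mono by (simp_all add: incseq_def)
      then have "x \<in> B (max j k)" "(T ^^ i) x \<in> B (max j k)" using that by auto
      then show False using free[of "max j k"] that by (auto simp: free_set_def)
    qed
    ultimately show "free_set N (\<Union>j. B j)" by (auto simp: free_set_def)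
  next
    fix x j assume x: "x \<in> W j"
    show "\<exists>i<Suc N. (T ^^ i) x \<in> (\<Union>j. B j) \<or> (S ^^ i) x \<in> (\<Union>j. B j)"
    proof (cases "\<forall>i<N. (T ^^ i) x \<notin> B j \<and> (S ^^ i) x \<notin> B j")
      case True
      then have "x \<in> B (Suc j)" using x by (auto simp: BS step_def)
      \<comment> \<open>The bound \<open>Suc N\<close> keeps the witness 0 admissible also for
        \<open>N = 0\<close>.\<close>
      then show ?thesis by (intro exI[of _ 0]) auto
    next
      case False
      then show ?thesis using less_SucI by blast
    qed
  qed
qed

text \<open>Cut the orbit, going forward from each visit to the marker set, into blocks of length \<open>H\<close>;
  only the incomplete blocks just before the next visit are lost.\<close>

lemma tower_from_marker:
  assumes B: "free_set N B" and N: "N > 0" and H: "H > 0"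
    and cover: "AE x in M. \<exists>k. (S ^^ k) x \<in> B"
  obtains Q where "Q \<in> sets M"
    "\<And>y i j. y \<in> space M \<Longrightarrow> i < H \<Longrightarrow> j < H \<Longrightarrow> (S ^^ i) y \<in> Q \<Longrightarrow> (S ^^ j) y \<in> Q \<Longrightarrow> i = j"
    "measure M {y \<in> space M. \<forall>i<H. (S ^^ i) y \<notin> Q} \<le> real H / real N"
proof -
  have [measurable]: "B \<in> sets M" using B by (simp add: free_set_def)
  \<comment> \<open>\<open>\<tau> x k\<close> says that the most recent visit to \<open>B\<close>,
    the present included, was \<open>k\<close> steps ago; call \<open>k\<close> the age of
    \<open>x\<close>.\<close>
  define \<tau> where "\<tau> x k \<longleftrightarrow> (S ^^ k) x \<in> B \<and> (\<forall>j<k. (S ^^ j) x \<notin> B)" for x k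
  have \<tau>_unique: "k = j" if "\<tau> x k" "\<tau> x j" for x k j
    using that unfolding \<tau>_def by (metis linorder_neqE_nat)
  have \<tau>_ex: "\<exists>k. \<tau> x k" if "(S ^^ k) x \<in> B" for x k
    unfolding \<tau>_def using exists_least_iff[of "\<lambda>k. (S ^^ k) x \<in> B"] that by blast
  \<comment> \<open>Base points start a complete block: their age is a multiple of \<open>H\<close>,
    and no marker occurs in the following \<open>H - 1\<close> steps.\<close>
  define Q where "Q = {x \<in> space M. (\<exists>k. H dvd k \<and> \<tau> x k) \<and> (\<forall>i<H. i = 0 \<or> (T ^^ i) x \<notin> B)}"
  show ?thesis
  proof (rule that[of Q])
    show Q [measurable]: "Q \<in> sets M" unfolding Q_def \<tau>_def by measurable
    \<comment> \<open>The level is forced: it is the age of \<open>y\<close> modulo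
      \<open>H\<close>.\<close>
    have lev: "\<exists>k. \<tau> y k \<and> k mod H = i" if y: "y \<in> space M" and i: "i < H" and Q: "(S ^^ i) y \<in> Q" for y i
    proof -
      obtain k where k: "H dvd k" "\<tau> ((S ^^ i) y) k" using Q by (auto simp: Q_def)
      have "(S ^^ (k + i)) y \<in> B" using k by (simp add: \<tau>_def funpow_add)
      moreover have "(S ^^ j) y \<notin> B" if j: "j < k + i" for j
      proof (cases "j < i")
        case True
        then have "(S ^^ j) y = (T ^^ (i - j)) ((S ^^ i) y)" using y by (simp add: funpow_T_S)
        moreover have "i - j < H" "i - j \<noteq> 0" using True i by auto
        ultimately show ?thesis using Q by (auto simp: Q_def)
      next
        case False
        then have "(S ^^ j) y = (S ^^ (j - i)) ((S ^^ i) y)" 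
          by (metis comp_apply funpow_add le_add_diff_inverse2 not_less)
        then show ?thesis using k j False by (auto simp: \<tau>_def)
      qed
      ultimately have "\<tau> y (k + i)" by (auto simp: \<tau>_def)
      then show ?thesis using k i by (intro exI[of _ "k + i"]) (auto elim!: dvdE)
    qed
    show "i = j" if "y \<in> space M" "i < H" "j < H" "(S ^^ i) y \<in> Q" "(S ^^ j) y \<in> Q" for y i j
      using lev[of y i] lev[of y j] that \<tau>_unique by blast
    let ?off = "{y \<in> space M. \<forall>i<H. (S ^^ i) y \<notin> Q}"
    \<comment> \<open>A point off the tower lies in a block that is cut short, so it reaches
      \<open>B\<close> in fewer than \<open>H\<close> forward steps.\<close>
    let ?U = "\<Union>k\<in>{..<H}. {y \<in> space M. (T ^^ k) y \<in> B}"
    have "AE y in M. y \<in> ?off \<longrightarrow> y \<in> ?U"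
      using cover
    proof eventually_elim
      case (elim y)
      show ?case
      proof
        assume off: "y \<in> ?off"
        then have y: "y \<in> space M" by simp
        obtain k where k: "\<tau> y k" using elim \<tau>_ex by blast
        define i where "i = k mod H"
        have i: "i < H" "i \<le> k" using H by (auto simp: i_def)
        \<comment> \<open>\<open>x\<close> starts the block of \<open>y\<close>. Its age is a
          multiple of \<open>H\<close>, so it can miss \<open>Q\<close> only through a marker fewer
          than \<open>H\<close> steps ahead. That marker lies strictly ahead of \<open>y\<close>:
          otherwise it would be more recent than the last visit.\<close>
        define x where "x = (S ^^ i) y"
        have xQ: "x \<notin> Q" "x \<in> space M" using off i y by (auto simp: x_def funpow_S_space)
        have sx: "(S ^^ j) x = (S ^^ (j + i)) y" for j by (simp add: x_def funpow_add)
        have "\<tau> x (k - i)" using k i unfolding \<tau>_def sx by auto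
        moreover have "H dvd k - i" unfolding i_def by (rule dvd_minus_mod)
        ultimately obtain j where j: "j < H" "j \<noteq> 0" "(T ^^ j) x \<in> B" using xQ by (auto simp: Q_def)
        have "j > i"
        proof (rule ccontr)
          assume "\<not> j > i"
          then have "(S ^^ (i - j)) y \<in> B" using j y by (simp add: x_def funpow_T_S)
          then show False using k i j \<open>\<not> j > i\<close> by (auto simp: \<tau>_def)
        qed
        then have "(T ^^ (j - i)) y \<in> B" using j y by (simp add: x_def funpow_T_S')
        moreover have "j - i < H" using j by simp
        ultimately show "y \<in> ?U" using y by blast
      qed
    qed
    then have "measure M ?off \<le> measure M ?U" by (intro finite_measure_mono_AE) auto
    also have "\<dots> \<le> real (card {..<H}) * measure M B"
      by (rule measure_UN_le) (auto simp: measure_T)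
    also have "\<dots> \<le> real H * (1 / N)"
      using free_set_measure[OF B] N by (intro mult_mono) (auto simp: field_simps)
    finally show "measure M ?off \<le> real H / N" by simp
  qed
qed

text \<open>The form in which the structure of a Lebesgue space enters the tower
  construction.\<close>

definition separating :: "'a set set \<Rightarrow> bool" where
  "separating \<D> \<longleftrightarrow> countable \<D> \<and> \<D> \<subseteq> sets M \<and>
     (\<exists>N\<in>null_sets M. \<forall>x\<in>space M - N. \<forall>y\<in>space M - N. x \<noteq> y \<longrightarrow> (\<exists>D\<in>\<D>. (x \<in> D) \<noteq> (y \<in> D)))"

text \<open>An aperiodic point \<open>x\<close> differs from its next \<open>N - 1\<close> iterates,
  so finitely many sets contain \<open>x\<close> while each of these iterates misses one of them.
  There are only countably many finite lists of such sets, and almost every point is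
  covered.\<close>

lemma free_cover:
  assumes sep: "separating \<D>"
    and aper: "AE x in M. \<forall>n\<ge>1. (T ^^ n) x \<noteq> x"
  obtains W :: "nat \<Rightarrow> 'a set" where "\<forall>j. free_set N (W j)" "AE x in M. \<exists>j. x \<in> W j"
proof -
  \<comment> \<open>With complements, a separating set can always be taken to contain
    \<open>x\<close>.\<close>
  define \<D>' where "\<D>' = \<D> \<union> (\<lambda>D. space M - D) ` \<D>"
  have ct: "countable (lists \<D>')" using sep by (auto simp: separating_def \<D>'_def)
  have D's: "D \<in> sets M" if "D \<in> \<D>'" for D using that sep by (auto simp: separating_def \<D>'_def)
  \<comment> \<open>\<open>V ds\<close> is free by construction: its points lie in every set of
    \<open>ds\<close>, while their iterates up to \<open>N - 1\<close> miss one.\<close>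
  define V where "V ds = {x \<in> space M. (\<forall>D\<in>set ds. x \<in> D) \<and> (\<forall>i\<in>{1..<N}. \<exists>D\<in>set ds. (T ^^ i) x \<notin> D)}" for ds
  have V: "free_set N (V ds)" if "ds \<in> lists \<D>'" for ds
  proof -
    have [measurable]: "D \<in> sets M" if "D \<in> set ds" for D
      using that \<open>ds \<in> lists \<D>'\<close> D's by auto
    have "V ds \<in> sets M" unfolding V_def by measurable
    then show ?thesis by (fastforce simp: free_set_def V_def)
  qed
  have ne: "lists \<D>' \<noteq> {}" by auto
  define W where "W = V \<circ> from_nat_into (lists \<D>')"
  show ?thesis
  proof (rule that[of W])
    show "\<forall>j. free_set N (W j)" unfolding W_def using V from_nat_into[OF ne] by auto
    obtain Z where Z: "Z \<in> null_sets M"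
      "\<And>x y. x \<in> space M - Z \<Longrightarrow> y \<in> space M - Z \<Longrightarrow> x \<noteq> y \<Longrightarrow> \<exists>D\<in>\<D>. (x \<in> D) \<noteq> (y \<in> D)"
      using sep unfolding separating_def by blast
    have "AE x in M. (T ^^ i) x \<notin> Z" for i
    proof -
      have "AE x in distr M M (T ^^ i). x \<notin> Z" using Z(1) by (simp add: distr_funpow_T AE_not_in)
      then show ?thesis by (rule AE_distrD[rotated]) measurable
    qed
    then have "AE x in M. \<forall>i. (T ^^ i) x \<notin> Z" by (simp add: AE_all_countable)
    with aper AE_space show "AE x in M. \<exists>j. x \<in> W j"
    proof eventually_elim
      case (elim x)
      have "\<exists>D\<in>\<D>'. x \<in> D \<and> (T ^^ i) x \<notin> D" if i: "i \<in> {1..<N}" for i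
      proof -
        have "x \<in> space M - Z" using elim(3)[rule_format, of 0] elim(2) by simp
        moreover have "(T ^^ i) x \<in> space M - Z" using elim by (simp add: funpow_T_space)
        ultimately obtain D where "D \<in> \<D>" "(x \<in> D) \<noteq> ((T ^^ i) x \<in> D)"
          using Z(2)[of x "(T ^^ i) x"] elim i by fastforce
        then show ?thesis using elim(2) funpow_T_space[OF elim(2), of i] by (cases "x \<in> D") (auto simp: \<D>'_def)
      qed
      then obtain D where D: "\<And>i. i \<in> {1..<N} \<Longrightarrow> D i \<in> \<D>' \<and> x \<in> D i \<and> (T ^^ i) x \<notin> D i" by metis
      let ?ds = "map D [1..<N]"
      have ds: "?ds \<in> lists \<D>'" using D by auto
      have "\<exists>E\<in>set ?ds. (T ^^ i) x \<notin> E" if "i \<in> {1..<N}" for i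
        using D[OF that] that by (intro bexI[of _ "D i"]) auto
      then have "x \<in> V ?ds" using D elim(2) by (auto simp: V_def)
      moreover have "W (to_nat_on (lists \<D>') ?ds) = V ?ds" using ct ds by (simp add: W_def)
      ultimately show ?case by blast
    qed
  qed
qed

text \<open>Markers are spaced by at least \<open>N\<close> with \<open>H / N\<close> <=
  \<open>\<delta>\<close>, so the incomplete blocks before them have measure at most
  \<open>\<delta>\<close>.\<close>

lemma rokhlin_tower:
  assumes sep: "separating \<D>"
    and aper: "AE x in M. \<forall>n\<ge>1. (T ^^ n) x \<noteq> x"
    and H: "H > 0" and \<delta>: "\<delta> > 0"
  obtains Q where "Q \<in> sets M"
    "\<And>y i j. y \<in> space M \<Longrightarrow> i < H \<Longrightarrow> j < H \<Longrightarrow> (S ^^ i) y \<in> Q \<Longrightarrow> (S ^^ j) y \<in> Q \<Longrightarrow> i = j"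
    "measure M {y \<in> space M. \<forall>i<H. (S ^^ i) y \<notin> Q} \<le> \<delta>"
proof -
  define N where "N = Suc (nat \<lceil>real H / \<delta>\<rceil>)"
  have N: "N > 0" by (simp add: N_def)
  have "real H / \<delta> \<le> real N" unfolding N_def by linarith
  then have HN: "real H / real N \<le> \<delta>" using N \<delta> by (simp add: field_simps)
  obtain W :: "nat \<Rightarrow> 'a set" where W: "\<forall>j. free_set N (W j)" and cW: "AE x in M. \<exists>j. x \<in> W j"
    by (rule free_cover[OF sep aper, of N]) (rule that; assumption)
  have W': "free_set N (W j)" for j using W by blast
  obtain B where B: "free_set N B"
    and cB: "\<And>x j. x \<in> W j \<Longrightarrow> \<exists>i<Suc N. (T ^^ i) x \<in> B \<or> (S ^^ i) x \<in> B"
    by (rule marker_set[OF W']) (rule that; assumption)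
  \<comment> \<open>A marker at most \<open>N\<close> steps away from \<open>(S ^^ N) x\<close>, in
    either direction, is never ahead of \<open>x\<close>. Going back \<open>N\<close> steps thus
    turns the two-sided covering into a backward one.\<close>
  have "AE x in distr M M (S ^^ N). \<exists>j. x \<in> W j" using cW unfolding distr_funpow_S .
  then have "AE x in M. \<exists>j. (S ^^ N) x \<in> W j" by (rule AE_distrD[rotated]) measurable
  with AE_space have "AE x in M. \<exists>k. (S ^^ k) x \<in> B"
  proof eventually_elim
    case (elim x)
    then obtain i where i: "i \<le> N" "(T ^^ i) ((S ^^ N) x) \<in> B \<or> (S ^^ i) ((S ^^ N) x) \<in> B"
      using cB by (metis less_Suc_eq_le)
    then have "(S ^^ (N - i)) x \<in> B \<or> (S ^^ (i + N)) x \<in> B"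
      using elim by (simp add: funpow_T_S funpow_add)
    then show ?case by blast
  qed
  then obtain Q where "Q \<in> sets M"
    "\<And>y i j. y \<in> space M \<Longrightarrow> i < H \<Longrightarrow> j < H \<Longrightarrow> (S ^^ i) y \<in> Q \<Longrightarrow> (S ^^ j) y \<in> Q \<Longrightarrow> i = j"
    "measure M {y \<in> space M. \<forall>i<H. (S ^^ i) y \<notin> Q} \<le> real H / real N"
    by (rule tower_from_marker[OF B N H]) (rule that; assumption)
  then show ?thesis using HN by (intro that[of Q]) auto
qed

end

section \<open>Closeness to empirical distributions\<close>

text \<open>Positions are counted, so repeated entries carry their multiplicity.\<close>

definition ecdf :: "real list \<Rightarrow> real \<Rightarrow> real" where
  "ecdf t x = real (card {j. j < length t \<and> t ! j \<le> x}) / real (length t)"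

context prob_space
begin

text \<open>These are the inequalities of the Levy metric between the law of \<open>Y\<close> and
  the empirical measure of \<open>t\<close>.\<close>

definition levy_near :: "('a \<Rightarrow> real) \<Rightarrow> real list \<Rightarrow> real \<Rightarrow> bool" where
  "levy_near Y t \<gamma> \<longleftrightarrow> (\<forall>x. prob {y \<in> space M. Y y \<le> x} \<le> ecdf t (x + \<gamma>) + \<gamma> \<and>
     ecdf t (x - \<gamma>) - \<gamma> \<le> prob {y \<in> space M. Y y \<le> x})"

text \<open>Up to \<open>R\<close>, a half-line event is covered by those \<open>G j\<close> whose
  \<open>t ! j\<close> it can reach. The lower estimate comes from the complementary event, so upper
  bounds on the measures of the \<open>G j\<close> suffice.\<close>

lemma levy_near_partition:
  assumes [measurable]: "Y \<in> borel_measurable M" "R \<in> sets M"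
    and t: "t \<noteq> []"
    and G [measurable]: "\<And>j. G j \<in> sets M"
    and Gm: "\<And>j. j < length t \<Longrightarrow> prob (G j) \<le> 1 / real (length t)"
    and R: "prob R \<le> \<gamma>"
    and near: "\<And>y. y \<in> space M - R \<Longrightarrow> \<exists>j<length t. y \<in> G j \<and> \<bar>Y y - t ! j\<bar> \<le> \<gamma>"
  shows "levy_near Y t \<gamma>"
  unfolding levy_near_def
proof (intro allI conjI)
  fix x
  have bound: "prob X \<le> real (card J) / real (length t) + \<gamma>"
    if X: "X \<subseteq> R \<union> (\<Union>j\<in>J. G j)" and J: "J \<subseteq> {..<length t}" for X J
  proof -
    have fin: "finite J" using J finite_subset by blast
    have "prob X \<le> prob (R \<union> (\<Union>j\<in>J. G j))"
      using X fin by (intro finite_measure_mono) auto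
    also have "\<dots> \<le> prob R + prob (\<Union>j\<in>J. G j)"
      using fin by (intro measure_Un_le) auto
    also have "prob (\<Union>j\<in>J. G j) \<le> (\<Sum>j\<in>J. prob (G j))"
      using fin by (intro finite_measure_subadditive_finite) auto
    also have "\<dots> \<le> (\<Sum>j\<in>J. 1 / real (length t))" using J by (intro sum_mono Gm) auto
    finally show ?thesis using R by simp
  qed
  show "prob {y \<in> space M. Y y \<le> x} \<le> ecdf t (x + \<gamma>) + \<gamma>"
    unfolding ecdf_def
  proof (rule bound)
    show "{y \<in> space M. Y y \<le> x} \<subseteq> R \<union> (\<Union>j\<in>{j. j < length t \<and> t ! j \<le> x + \<gamma>}. G j)"
    proof
      fix y assume y: "y \<in> {y \<in> space M. Y y \<le> x}"
      show "y \<in> R \<union> (\<Union>j\<in>{j. j < length t \<and> t ! j \<le> x + \<gamma>}. G j)"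
        using near[of y] y by (cases "y \<in> R") (force simp: abs_le_iff)+
    qed
  qed auto
  let ?J = "{j. j < length t \<and> t ! j \<le> x - \<gamma>}"
  have "prob {y \<in> space M. \<not> Y y \<le> x} \<le> real (card ({..<length t} - ?J)) / real (length t) + \<gamma>"
  proof (rule bound)
    show "{y \<in> space M. \<not> Y y \<le> x} \<subseteq> R \<union> (\<Union>j\<in>{..<length t} - ?J. G j)"
    proof
      fix y assume y: "y \<in> {y \<in> space M. \<not> Y y \<le> x}"
      show "y \<in> R \<union> (\<Union>j\<in>{..<length t} - ?J. G j)"
        using near[of y] y by (cases "y \<in> R") (force simp: abs_le_iff)+
    qed
  qed auto
  also have "card ({..<length t} - ?J) = length t - card ?J"
    by (subst card_Diff_subset) auto
  also have "real (length t - card ?J) / real (length t) = 1 - ecdf t (x - \<gamma>)"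
  proof -
    have "card ?J \<le> card {..<length t}" by (intro card_mono) auto
    then show ?thesis using t by (simp add: ecdf_def of_nat_diff diff_divide_distrib)
  qed
  also have "prob {y \<in> space M. \<not> Y y \<le> x} = 1 - prob {y \<in> space M. Y y \<le> x}"
    by (rule prob_neg) measurable
  finally show "ecdf t (x - \<gamma>) - \<gamma> \<le> prob {y \<in> space M. Y y \<le> x}" by simp
qed

text \<open>A triangle inequality: shifting the threshold by \<open>\<eta>\<close> costs at most the
  probability that \<open>Y\<close> and \<open>Z\<close> differ by more than
  \<open>\<eta>\<close>.\<close>

lemma levy_near_perturb:
  assumes [measurable]: "Y \<in> borel_measurable M" "Z \<in> borel_measurable M"
    and near: "levy_near Y t \<gamma>"
    and diff: "prob {y \<in> space M. \<bar>Y y - Z y\<bar> > \<eta>} \<le> \<eta>"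
  shows "levy_near Z t (\<gamma> + \<eta>)"
  unfolding levy_near_def
proof (intro allI conjI)
  fix x
  let ?D = "{y \<in> space M. \<bar>Y y - Z y\<bar> > \<eta>}"
  have "prob {y \<in> space M. Z y \<le> x} \<le> prob ({y \<in> space M. Y y \<le> x + \<eta>} \<union> ?D)"
    by (intro finite_measure_mono) auto
  also have "\<dots> \<le> prob {y \<in> space M. Y y \<le> x + \<eta>} + prob ?D"
    by (intro measure_Un_le) auto
  also have "prob {y \<in> space M. Y y \<le> x + \<eta>} \<le> ecdf t (x + \<eta> + \<gamma>) + \<gamma>"
    using near by (simp add: levy_near_def)
  finally show "prob {y \<in> space M. Z y \<le> x} \<le> ecdf t (x + (\<gamma> + \<eta>)) + (\<gamma> + \<eta>)"
    using diff by (simp add: algebra_simps)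
  have "ecdf t (x - \<eta> - \<gamma>) - \<gamma> \<le> prob {y \<in> space M. Y y \<le> x - \<eta>}"
    using near by (simp add: levy_near_def)
  also have "\<dots> \<le> prob ({y \<in> space M. Z y \<le> x} \<union> ?D)"
    by (intro finite_measure_mono) auto
  also have "\<dots> \<le> prob {y \<in> space M. Z y \<le> x} + prob ?D"
    by (intro measure_Un_le) auto
  finally show "ecdf t (x - (\<gamma> + \<eta>)) - (\<gamma> + \<eta>) \<le> prob {y \<in> space M. Z y \<le> x}"
    using diff by (simp add: algebra_simps)
qed

end

section \<open>Rewriting a set along the columns of a tower\<close>

text \<open>\<open>Q\<close> is the base, and \<open>y\<close> stands on level \<open>i\<close> when
  \<open>(S ^^ i) y\<close> lies in \<open>Q\<close>.\<close>

locale tower = mp_system +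
  fixes H :: nat and Q :: "'a set"
  assumes H: "H > 0" and Q_meas [measurable]: "Q \<in> sets M"
    and level_unique: "\<And>y i j. y \<in> space M \<Longrightarrow> i < H \<Longrightarrow> j < H \<Longrightarrow> (S ^^ i) y \<in> Q \<Longrightarrow> (S ^^ j) y \<in> Q \<Longrightarrow> i = j"
begin

definition levels :: "nat set \<Rightarrow> 'a set" where
  "levels I = {y \<in> space M. \<exists>i\<in>I. (S ^^ i) y \<in> Q}"

definition off :: "'a set" where
  "off = {y \<in> space M. \<forall>i<H. (S ^^ i) y \<notin> Q}"

lemma levels_sets [measurable]: "levels I \<in> sets M"
  unfolding levels_def by measurable

lemma off_sets [measurable]: "off \<in> sets M"
  unfolding off_def by measurable

text \<open>A return to the base in fewer than \<open>H\<close> steps would put a point on two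
  levels, so \<open>Q\<close> is free.\<close>

lemma measure_Q: "measure M Q \<le> 1 / real H"
proof -
  have "free_set H Q"
    unfolding free_set_def
  proof (intro conjI ballI allI impI notI)
    fix x i assume x: "x \<in> Q" and i: "1 \<le> i" "i < H" and T: "(T ^^ i) x \<in> Q"
    then have "x \<in> space M" using Q_meas sets.sets_into_space by blast
    then have "(S ^^ i) ((T ^^ i) x) \<in> Q" "(S ^^ 0) ((T ^^ i) x) \<in> Q" "(T ^^ i) x \<in> space M"
      using x T by (auto simp: funpow_S_T_same funpow_T_space)
    then show False using level_unique[of "(T ^^ i) x" i 0] i H by auto
  qed measurable
  then show ?thesis using free_set_measure H by (simp add: field_simps)
qed

lemma measure_levels:
  assumes "finite I"
  shows "measure M (levels I) \<le> real (card I) / real H"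
proof -
  have "levels I = (\<Union>i\<in>I. {y \<in> space M. (S ^^ i) y \<in> Q})" by (auto simp: levels_def)
  also have "measure M \<dots> \<le> real (card I) * (1 / real H)"
    using assms measure_Q by (intro measure_UN_le) (auto simp: measure_S)
  finally show ?thesis by simp
qed

text \<open>Truncation at \<open>H\<close> leaves finitely many words, so an arbitrary rewriting
  rule preserves measurability.\<close>

definition word :: "'a set \<Rightarrow> 'a \<Rightarrow> nat set" where
  "word A x = {k. k < H \<and> (T ^^ k) x \<in> A}"

definition rewrite :: "(nat set \<Rightarrow> nat set) \<Rightarrow> 'a set \<Rightarrow> 'a set" where
  "rewrite F A = {y \<in> space M. \<exists>i<H. (S ^^ i) y \<in> Q \<and> i \<in> F (word A ((S ^^ i) y))}"

lemma word_sets: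
  assumes [measurable]: "A \<in> sets M"
  shows "{x \<in> space M. i \<in> F (word A x)} \<in> sets M"
proof -
  have word: "word A x = V \<longleftrightarrow> (\<forall>k<H. ((T ^^ k) x \<in> A) = (k \<in> V))" if "V \<subseteq> {..<H}" for x V
    using that by (auto simp: word_def)
  have "word A x \<subseteq> {..<H}" for x by (auto simp: word_def)
  then have "{x \<in> space M. i \<in> F (word A x)} =
    (\<Union>V\<in>{V. V \<subseteq> {..<H} \<and> i \<in> F V}. {x \<in> space M. word A x = V})" by auto
  also have "\<dots> =
    (\<Union>V\<in>{V. V \<subseteq> {..<H} \<and> i \<in> F V}. {x \<in> space M. \<forall>k<H. ((T ^^ k) x \<in> A) = (k \<in> V)})"
    using word by (intro SUP_cong) auto
  also have "\<dots> \<in> sets M"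
  proof (rule sets.finite_UN)
    show "finite {V. V \<subseteq> {..<H} \<and> i \<in> F V}"
      by (rule finite_subset[of _ "Pow {..<H}"]) auto
  qed measurable
  finally show ?thesis .
qed

lemma rewrite_sets [measurable]:
  assumes [measurable]: "A \<in> sets M"
  shows "rewrite F A \<in> sets M"
proof -
  have [measurable]: "{x \<in> space M. i \<in> F (word A x)} \<in> sets M" for i
    by (rule word_sets) fact
  have "rewrite F A = (\<Union>i\<in>{..<H}. {y \<in> space M. (S ^^ i) y \<in> Q \<and> (S ^^ i) y \<in> {x \<in> space M. i \<in> F (word A x)}})"
    by (auto simp: rewrite_def funpow_S_space)
  also have "\<dots> \<in> sets M" by measurable
  finally show ?thesis .
qed

lemma rewrite_iff:
  assumes "y \<in> space M" "i < H" "(S ^^ i) y \<in> Q"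
  shows "y \<in> rewrite F A \<longleftrightarrow> i \<in> F (word A ((S ^^ i) y))"
  using assms level_unique[OF assms(1)] by (auto simp: rewrite_def)

lemma rewrite_iff_column:
  assumes "x \<in> space M" "x \<in> Q" "k < H"
  shows "(T ^^ k) x \<in> rewrite F A \<longleftrightarrow> k \<in> F (word A x)"
  using rewrite_iff[of "(T ^^ k) x" k F A] assms by (simp add: funpow_S_T_same funpow_T_space)

end

section \<open>Approximate coboundaries\<close>

context mp_system
begin

text \<open>A quantitative substitute for: the conditional measure of \<open>A\<close> given the invariant sets is \<open>c\<close>.\<close>

definition balanced :: "real \<Rightarrow> 'a set \<Rightarrow> real \<Rightarrow> real \<Rightarrow> bool" where
  "balanced c A K \<delta> \<longleftrightarrow> (\<exists>g E. g \<in> borel_measurable M \<and> (\<forall>x\<in>space M. \<bar>g x\<bar> \<le> K) \<and> E \<in> sets M \<and> measure M E \<le> \<delta> \<and>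
     (\<forall>x\<in>space M - E. indicator A x - c = g x - g (T x)))"

text \<open>The coboundary telescopes to a difference of two values of \<open>g\<close>.\<close>

lemma coboundary_sum:
  fixes g :: "'a \<Rightarrow> real"
  assumes g: "\<And>x. x \<in> space M \<Longrightarrow> \<bar>g x\<bar> \<le> K"
    and cob: "\<And>x. x \<in> space M - E \<Longrightarrow> indicator A x - c = g x - g (T x)"
    and x: "x \<in> space M" and E: "\<And>k. k < H \<Longrightarrow> (T ^^ k) x \<notin> E" and ij: "i \<le> j" "j \<le> H"
  shows "\<bar>\<Sum>k\<in>{i..<j}. indicator A ((T ^^ k) x) - c\<bar> \<le> 2 * K"
proof -
  have "(\<Sum>k\<in>{i..<j}. indicator A ((T ^^ k) x) - c) = (\<Sum>k\<in>{i..<j}. g ((T ^^ k) x) - g ((T ^^ Suc k) x))"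
    using x E ij by (intro sum.cong refl) (simp add: cob funpow_T_space)
  also have "\<dots> = g ((T ^^ i) x) - g ((T ^^ j) x)"
    using sum_Suc_diff'[of i j "\<lambda>k. - g ((T ^^ k) x)"] ij by simp
  finally show ?thesis using g[of "(T ^^ i) x"] g[of "(T ^^ j) x"] x by (simp add: funpow_T_space)
qed

text \<open>The difference of \<open>g\<close> and \<open>g \<circ> T\<close> has integral 0; the
  defect vanishes off \<open>E\<close> and is at most \<open>1 + 2 * K\<close> on it.\<close>

lemma balanced_measure:
  assumes A [measurable]: "A \<in> sets M" and bal: "balanced c A K \<delta>"
    and c: "0 \<le> c" "c \<le> 1" and K: "K \<ge> 0"
  shows "\<bar>measure M A - c\<bar> \<le> (1 + 2 * K) * \<delta>"
proof -
  obtain g E where g [measurable]: "g \<in> borel_measurable M" and gK: "\<And>x. x \<in> space M \<Longrightarrow> \<bar>g x\<bar> \<le> K"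
    and E [measurable]: "E \<in> sets M" and E\<delta>: "measure M E \<le> \<delta>"
    and cob: "\<And>x. x \<in> space M - E \<Longrightarrow> indicator A x - c = g x - g (T x)"
    using bal unfolding balanced_def by blast
  have [simp]: "integrable M g" using gK by (intro integrable_const_bound[of _ K]) auto
  have [simp]: "integrable M (\<lambda>x. g (T x))"
    using gK T_space by (intro integrable_const_bound[of _ K]) auto
  have [simp]: "integrable M (indicator E :: _ \<Rightarrow> real)" "integrable M (indicator A :: _ \<Rightarrow> real)"
    by (auto simp: integrable_indicator_iff emeasure_eq_measure)
  have gT: "(\<integral>x. g (T x) \<partial>M) = (\<integral>x. g x \<partial>M)"
    using integral_distr[of T M M g] by (simp add: distr_T)
  have "measure M A - c = (\<integral>x. indicator A x - c - (g x - g (T x)) \<partial>M)"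
    by (simp add: gT prob_space)
  moreover have "\<bar>\<dots>\<bar> \<le> (\<integral>x. \<bar>indicator A x - c - (g x - g (T x))\<bar> \<partial>M)"
    by (rule integral_abs_bound)
  moreover have "\<dots> \<le> (\<integral>x. (1 + 2 * K) * indicator E x \<partial>M)"
  proof (rule integral_mono)
    fix x assume x: "x \<in> space M"
    have "\<bar>g x\<bar> \<le> K" "\<bar>g (T x)\<bar> \<le> K" using x gK T_space by auto
    moreover have "\<bar>indicator A x - c\<bar> \<le> 1" using c by (auto simp: indicator_def)
    ultimately show "\<bar>indicator A x - c - (g x - g (T x))\<bar> \<le> (1 + 2 * K) * indicator E x"
      using cob[of x] x by (cases "x \<in> E") auto
  qed auto
  moreover have "(\<integral>x. (1 + 2 * K) * indicator E x \<partial>M) = (1 + 2 * K) * measure M E" by simp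
  moreover have "(1 + 2 * K) * measure M E \<le> (1 + 2 * K) * \<delta>"
    using K E\<delta> by (intro mult_left_mono) auto
  ultimately show ?thesis by linarith
qed

end

context tower
begin

text \<open>The transfer function at level \<open>i\<close> is minus the partial sum of the new word
  below \<open>i\<close>. Since the total over a column is zero, the coboundary identity holds at
  the top level too, and only \<open>off\<close> is exceptional.\<close>

lemma balanced_rewrite:
  assumes A [measurable]: "A \<in> sets M"
    and F: "\<And>W. (\<Sum>k<H. indicator (F W) k - c) = (0::real)" and c: "0 \<le> c" "c \<le> 1"
    and off: "measure M off \<le> \<delta>"
  shows "balanced c (rewrite F A) (real H) \<delta>"
proof -
  define U where "U x i = (\<Sum>k<i. indicator (F (word A x)) k - c)" for x i
  \<comment> \<open>By uniqueness of the level at most one term is nonzero; off the tower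
    \<open>g\<close> is 0.\<close>
  define g where "g y = (\<Sum>i<H. if (S ^^ i) y \<in> Q then - U ((S ^^ i) y) i else 0)" for y
  have [measurable]: "{x \<in> space M. k \<in> F (word A x)} \<in> sets M" for k
    by (rule word_sets) fact
  have U [measurable]: "(\<lambda>x. U x i) \<in> borel_measurable M" for i
  proof -
    have "U x i = (\<Sum>k<i. indicator {x \<in> space M. k \<in> F (word A x)} x - c)" if "x \<in> space M" for x
      using that unfolding U_def by (intro sum.cong) (auto simp: indicator_def)
    then show ?thesis by (subst measurable_cong) (assumption, measurable)
  qed
  have [measurable]: "(\<lambda>y. U ((S ^^ i) y) i) \<in> borel_measurable M" for i
    by (rule measurable_compose[OF funpow_S_meas U])
  have g: "g y = - U ((S ^^ i) y) i" if y: "y \<in> space M" "i < H" "(S ^^ i) y \<in> Q" for y i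
  proof -
    have "g y = (\<Sum>j<H. if j = i then - U ((S ^^ i) y) i else 0)"
      unfolding g_def using y level_unique[OF y(1)] by (intro sum.cong) auto
    then show ?thesis using y by simp
  qed
  have g0: "g y = 0" if "\<And>i. i < H \<Longrightarrow> (S ^^ i) y \<notin> Q" for y
    using that by (simp add: g_def)
  show ?thesis
    unfolding balanced_def
  proof (intro exI[of _ g] exI[of _ off] conjI ballI)
    show "g \<in> borel_measurable M" unfolding g_def by measurable
  next
    fix y assume y: "y \<in> space M"
    show "\<bar>g y\<bar> \<le> real H"
    proof (cases "\<exists>i<H. (S ^^ i) y \<in> Q")
      case True
      then obtain i where i: "i < H" "(S ^^ i) y \<in> Q" by auto
      have "\<bar>U ((S ^^ i) y) i\<bar> \<le> (\<Sum>k<i. \<bar>indicator (F (word A ((S ^^ i) y))) k - c\<bar>)"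
        unfolding U_def by (rule sum_abs)
      also have "\<dots> \<le> (\<Sum>k<i. 1)" using c by (intro sum_mono) (auto simp: indicator_def)
      also have "\<dots> \<le> real H" using i by simp
      finally show ?thesis using g[OF y i] by simp
    qed (auto simp: g0)
  next
    fix y assume "y \<in> space M - off"
    then obtain i where y: "y \<in> space M" and i: "i < H" "(S ^^ i) y \<in> Q" by (auto simp: off_def)
    have Ty: "T y \<in> space M" using y by (rule T_space)
    have ST: "(S ^^ Suc j) (T y) = (S ^^ j) y" for j
      using y by (simp add: funpow_Suc_right S_T del: funpow.simps(2))
    let ?x = "(S ^^ i) y"
    have "g (T y) = - U ?x (Suc i)"
    proof (cases "Suc i < H")
      case True
      then show ?thesis using g[OF Ty True] i by (simp only: ST)
    next
      case False
      \<comment> \<open>From the top level, \<open>T y\<close> goes either to the base, where the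
        partial sum is empty, or off the tower.\<close>
      then have "Suc i = H" using i by simp
      then have "U ?x (Suc i) = 0" by (simp only: U_def F)
      moreover have "g (T y) = 0"
      proof (cases "T y \<in> Q")
        case True
        then show ?thesis using g[OF Ty, of 0] H by (simp add: U_def)
      next
        case False
        have "(S ^^ j) (T y) \<notin> Q" if j: "j < H" for j
        proof (cases j)
          case 0 then show ?thesis using False by simp
        next
          case (Suc l)
          \<comment> \<open>If \<open>T y\<close> stood on level \<open>Suc l\<close>, then
            \<open>y\<close> would stand on level \<open>l\<close> besides its top level.\<close>
          have "l \<noteq> i" "l < H" using \<open>Suc i = H\<close> j Suc by auto
          then show ?thesis unfolding Suc ST using level_unique[OF y _ _ _ i(2)] i(1) by blast
        qed
        then show ?thesis by (rule g0)
      qed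
      ultimately show ?thesis by simp
    qed
    then have "g y - g (T y) = indicator (F (word A ?x)) i - c" using g[OF y i] by (simp add: U_def)
    also have "\<dots> = indicator (rewrite F A) y - c" using rewrite_iff[OF y i] by (simp add: indicator_def)
    finally show "indicator (rewrite F A) y - c = g y - g (T y)" by simp
  qed (use off in auto)
qed

end

text \<open>The periodic word is the pattern of the initial set and the default replacement for
  words without bounded sums.\<close>

lemma sum_indicator_multiples:
  fixes q H :: nat
  assumes "q > 0" "q dvd H"
  shows "(\<Sum>k<H. indicator {k. q dvd k} k - 1 / real q) = (0::real)"
proof -
  obtain h where h: "H = h * q" using assms by (metis dvd_def mult.commute)
  have "{..<H} \<inter> {k. q dvd k} = {i. i < h * q \<and> i mod q < 1}"
    unfolding h using assms by (auto simp: dvd_eq_mod_eq_0)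
  then have "card ({..<H} \<inter> {k. q dvd k}) = h" using card_mod_less[of 1 q h] assms by simp
  then show ?thesis using assms h by (simp add: sum_subtractf sum_indicator_card)
qed

section \<open>The inductive construction\<close>

locale aperiodic_system = mp_system +
  fixes \<D> :: "'a set set"
  assumes separating: "separating \<D>"
    and aperiodic: "AE x in M. \<forall>n\<ge>1. (T ^^ n) x \<noteq> x"
begin

lemma obtain_tower:
  assumes "H > 0" "\<delta> > 0"
  obtains Q where "tower M T S H Q" "measure M (tower.off M S H Q) \<le> \<delta>"
proof -
  obtain Q where Q: "Q \<in> sets M"
    "\<And>y i j. y \<in> space M \<Longrightarrow> i < H \<Longrightarrow> j < H \<Longrightarrow> (S ^^ i) y \<in> Q \<Longrightarrow> (S ^^ j) y \<in> Q \<Longrightarrow> i = j"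
    "measure M {y \<in> space M. \<forall>i<H. (S ^^ i) y \<notin> Q} \<le> \<delta>"
    by (rule rokhlin_tower[OF separating aperiodic assms]) (rule that; assumption)
  interpret tower M T S H Q by unfold_locales (use Q assms in auto)
  show ?thesis using Q(3) that[of Q] tower_axioms by (simp add: off_def)
qed

text \<open>In a tower of height \<open>q\<close> the only level divisible by \<open>q\<close> is 0,
  so the set is the base of the tower.\<close>

lemma balanced_exists:
  fixes q :: nat
  assumes q: "q > 0" and \<delta>: "\<delta> > 0"
  shows "\<exists>A\<in>sets M. balanced (1 / real q) A (real q) \<delta>"
proof -
  obtain Q where "tower M T S q Q" and off: "measure M (tower.off M S q Q) \<le> \<delta>"
    using obtain_tower[OF q \<delta>] by blast
  then interpret tower M T S q Q by simp
  have "(\<Sum>k<q. indicator {k. q dvd k} k - 1 / real q) = (0::real)"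
    using q by (intro sum_indicator_multiples) auto
  then have "balanced (1 / real q) (rewrite (\<lambda>_. {k. q dvd k}) {}) (real q) \<delta>"
    using q off by (intro balanced_rewrite) auto
  moreover have "rewrite (\<lambda>_. {k. q dvd k}) {} \<in> sets M" by (rule rewrite_sets) simp
  ultimately show ?thesis by blast
qed

text \<open>The order of the quantifiers matters: \<open>n\<close>, \<open>\<delta>\<close> and \<open>K'\<close> do not depend on \<open>A\<close>, so all
  scales can be fixed before any set is built.\<close>

lemma balanced_step:
  fixes t :: "real list" and a :: "nat \<Rightarrow> real" and q :: nat and K \<gamma> \<kappa> :: real
  assumes q: "q \<ge> 2" and K: "K \<ge> 0" and t: "t \<noteq> []" and \<gamma>: "\<gamma> > 0" and \<kappa>: "\<kappa> > 0"
    and a: "\<And>n. a n > 0" "filterlim a at_top sequentially" "(\<lambda>n. a n / real n) \<longlonglongrightarrow> 0"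
  shows "\<exists>n>0. \<exists>\<delta>>0. \<exists>K'\<ge>0. \<forall>A\<in>sets M. balanced (1 / real q) A K \<delta> \<longrightarrow>
    \<bar>measure M A - 1 / real q\<bar> \<le> \<kappa> \<and>
    (\<forall>\<delta>'>0. \<exists>A'\<in>sets M. balanced (1 / real q) A' K' \<delta>' \<and>
       measure M (sym_diff A A') \<le> \<kappa> \<and>
       levy_near (\<lambda>x. birkhoff_sum T (\<lambda>y. indicator A' y - 1 / real q) n x / a n) t \<gamma>)"
proof -
  define c where "c = 1 / real q"
  have c: "0 \<le> c" "c \<le> 1" using q by (auto simp: c_def)
  \<comment> \<open>Three small sets have to be added up: the complement of the tower, the columns
    meeting \<open>E\<close>, and some exceptional levels.\<close>
  define \<theta> where "\<theta> = min (\<gamma> / 3) (\<kappa> / 3)"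
  have \<theta>: "\<theta> > 0" "\<theta> \<le> \<gamma> / 3" "\<theta> \<le> \<kappa> / 3" using \<gamma> \<kappa> by (auto simp: \<theta>_def)
  have K2: "2 * K \<ge> 0" using K by simp
  obtain n H L :: nat and D :: "nat set" where
    n: "n > 0" and H: "H > 0" "q dvd H" and L: "n \<le> L" "length t * L \<le> H"
    and dense: "real (length t) * (real L - real n) \<ge> (1 - \<theta>) * real H"
    and D: "D \<subseteq> {..<H}" "real (card D) \<le> \<theta> * real H"
    and surgery: "\<forall>W. (\<forall>i j. i \<le> j \<longrightarrow> j \<le> H \<longrightarrow> \<bar>\<Sum>k\<in>{i..<j}. indicator W k - 1 / real q\<bar> \<le> 2 * K) \<longrightarrow>
      (\<exists>W'. (\<Sum>k<H. indicator W' k - 1 / real q) = 0 \<and> W' \<inter> {..<H} - D = W \<inter> {..<H} - D \<and>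
        (\<forall>j<length t. \<forall>m. j * L \<le> m \<longrightarrow> m + n \<le> Suc j * L \<longrightarrow>
          \<bar>(\<Sum>k\<in>{m..<m+n}. indicator W' k - 1 / real q) - a n * t ! j\<bar> \<le> \<theta> * a n))"
    by (rule word_surgery[OF q K2 t \<theta>(1) \<theta>(1) a]) (rule that; assumption)
  define good where "good W \<longleftrightarrow> (\<forall>i j. i \<le> j \<longrightarrow> j \<le> H \<longrightarrow> \<bar>\<Sum>k\<in>{i..<j}. indicator W k - c\<bar> \<le> 2 * K)" for W
  \<comment> \<open>Zero total is demanded of every new word, also when the old one is not
    \<open>good\<close>; the new exceptional set is then just the complement of the tower.\<close>
  define rep where "rep W W' \<longleftrightarrow> (\<Sum>k<H. indicator W' k - c) = 0 \<and> (good W \<longrightarrow> W' \<inter> {..<H} - D = W \<inter> {..<H} - D \<and>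
        (\<forall>j<length t. \<forall>m. j * L \<le> m \<longrightarrow> m + n \<le> Suc j * L \<longrightarrow>
          \<bar>(\<Sum>k\<in>{m..<m+n}. indicator W' k - c) - a n * t ! j\<bar> \<le> \<theta> * a n))" for W W'
  have "\<exists>W'. rep W W'" for W
  proof (cases "good W")
    case True
    then show ?thesis using surgery[rule_format, of W] unfolding rep_def good_def c_def by blast
  next
    case False
    then show ?thesis unfolding rep_def c_def
      using sum_indicator_multiples[of q H] q H by (intro exI[of _ "{k. q dvd k}"]) auto
  qed
  then obtain F where F: "\<And>W. rep W (F W)" by metis
  have L0: "L > 0" using n L by simp
  have r0: "length t > 0" using t by simp
  \<comment> \<open>The first bound controls the measure of \<open>A\<close>; the second pays for
    the \<open>H * H\<close> sets that make up \<open>Z\<close>.\<close>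
  define \<delta> where "\<delta> = min (\<kappa> / (1 + 2 * K)) (\<theta> / (real H * real H))"
  have \<delta>: "\<delta> > 0" using \<kappa> K \<theta> H by (simp add: \<delta>_def)
  have \<delta>1: "(1 + 2 * K) * \<delta> \<le> \<kappa>"
  proof -
    have "\<delta> \<le> \<kappa> / (1 + 2 * K)" by (simp add: \<delta>_def)
    then show ?thesis using K by (simp add: field_simps)
  qed
  have \<delta>2: "real H * real H * \<delta> \<le> \<theta>"
  proof -
    have "\<delta> \<le> \<theta> / (real H * real H)" by (simp add: \<delta>_def)
    then show ?thesis using H by (simp add: field_simps)
  qed
  have main: "\<exists>A'\<in>sets M. balanced c A' (real H) \<delta>' \<and> measure M (sym_diff A A') \<le> \<kappa> \<and>
      levy_near (\<lambda>x. birkhoff_sum T (\<lambda>y. indicator A' y - c) n x / a n) t \<gamma>"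
    if A [measurable]: "A \<in> sets M" and bal: "balanced c A K \<delta>" and \<delta>': "\<delta>' > 0" for A \<delta>'
  proof -
    obtain g E where gK: "\<And>x. x \<in> space M \<Longrightarrow> \<bar>g x\<bar> \<le> K"
      and E [measurable]: "E \<in> sets M" and E\<delta>: "measure M E \<le> \<delta>"
      and cob: "\<And>x. x \<in> space M - E \<Longrightarrow> indicator A x - c = g x - g (T x)"
      using bal unfolding balanced_def by blast
    have "min \<delta>' \<theta> > 0" using \<delta>' \<theta> by simp
    then obtain Q where tow: "tower M T S H Q" and off: "measure M (tower.off M S H Q) \<le> min \<delta>' \<theta>"
      using obtain_tower[OF H(1)] by blast
    interpret tower M T S H Q by fact
    define A' where "A' = rewrite F A"
    have A' [measurable]: "A' \<in> sets M" unfolding A'_def by (rule rewrite_sets) fact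
    have bal': "balanced c A' (real H) \<delta>'"
      unfolding A'_def by (rule balanced_rewrite) (use F off c in \<open>auto simp: rep_def\<close>)
    \<comment> \<open>The pair \<open>(i, k)\<close> runs over all possible levels of a point and
      all positions in its column: off \<open>Z\<close> the whole column avoids \<open>E\<close>,
      whatever the level.\<close>
    define Z where "Z = (\<Union>(i, k)\<in>{..<H} \<times> {..<H}. {y \<in> space M. (S ^^ i) y \<in> {x \<in> space M. (T ^^ k) x \<in> E}})"
    have [measurable]: "{y \<in> space M. (S ^^ i) y \<in> {x \<in> space M. (T ^^ k) x \<in> E}} \<in> sets M" for i k
      by measurable
    then have Z [measurable]: "Z \<in> sets M"
      unfolding Z_def by (intro sets.finite_UN) auto
    have "measure M {y \<in> space M. (S ^^ i) y \<in> {x \<in> space M. (T ^^ k) x \<in> E}} \<le> \<delta>" for i k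
      using E\<delta> by (subst measure_S) (simp_all add: measure_T)
    then have "measure M Z \<le> real (card ({..<H} \<times> {..<H})) * \<delta>"
      unfolding Z_def by (intro measure_UN_le) auto
    then have Zm: "measure M Z \<le> \<theta>" using \<delta>2 by simp
    have column: "good (word A ((S ^^ i) y))" if y: "y \<in> space M - Z" "i < H" for y i
      unfolding good_def
    proof (intro allI impI)
      fix i' j' assume ij: "i' \<le> j'" "j' \<le> H"
      let ?x = "(S ^^ i) y"
      have x: "?x \<in> space M" using y by (simp add: funpow_S_space)
      have "(\<Sum>k\<in>{i'..<j'}. indicator (word A ?x) k - c) = (\<Sum>k\<in>{i'..<j'}. indicator A ((T ^^ k) ?x) - c)"
        using ij by (intro sum.cong) (auto simp: word_def indicator_def)
      moreover have "\<bar>\<Sum>k\<in>{i'..<j'}. indicator A ((T ^^ k) ?x) - c\<bar> \<le> 2 * K"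
        using gK cob x _ ij
      proof (rule coboundary_sum)
        show "(T ^^ k) ?x \<notin> E" if "k < H" for k
          using y x that unfolding Z_def by auto
      qed
      ultimately show "\<bar>\<Sum>k\<in>{i'..<j'}. indicator (word A ?x) k - c\<bar> \<le> 2 * K" by simp
    qed
    \<comment> \<open>On a column with a \<open>good\<close> word the two sets agree at every level
      outside \<open>D\<close>.\<close>
    have "sym_diff A A' \<subseteq> (off \<union> Z) \<union> levels D"
    proof
      fix y assume y: "y \<in> sym_diff A A'"
      then have sp: "y \<in> space M" using sets.sets_into_space[OF A] sets.sets_into_space[OF A'] by blast
      show "y \<in> (off \<union> Z) \<union> levels D"
      proof (rule ccontr)
        assume n: "y \<notin> (off \<union> Z) \<union> levels D"
        then obtain i where i: "i < H" "(S ^^ i) y \<in> Q" using sp by (auto simp: off_def)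
        have "i \<notin> D" using n i sp by (auto simp: levels_def)
        let ?W = "word A ((S ^^ i) y)"
        have "F ?W \<inter> {..<H} - D = ?W \<inter> {..<H} - D"
          using F[of ?W] column[of y i] n sp i by (auto simp: rep_def)
        then have "i \<in> F ?W \<longleftrightarrow> i \<in> ?W" using i \<open>i \<notin> D\<close> by blast
        then have "y \<in> A' \<longleftrightarrow> (T ^^ i) ((S ^^ i) y) \<in> A"
          using rewrite_iff[OF sp i, of F A] i by (simp add: A'_def word_def)
        then show False using y sp by (auto simp: funpow_T_S_same)
      qed
    qed
    then have "measure M (sym_diff A A') \<le> measure M ((off \<union> Z) \<union> levels D)"
      by (intro finite_measure_mono) auto
    also have "\<dots> \<le> measure M (off \<union> Z) + measure M (levels D)" by (rule measure_Un_le) auto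
    also have "measure M (off \<union> Z) \<le> measure M off + measure M Z" by (rule measure_Un_le) auto
    also have "measure M (levels D) \<le> \<theta>"
    proof -
      have "measure M (levels D) \<le> real (card D) / real H"
        using D finite_subset by (intro measure_levels) auto
      also have "\<dots> \<le> \<theta>" using D(2) H by (simp add: field_simps)
      finally show ?thesis .
    qed
    finally have diff: "measure M (sym_diff A A') \<le> \<kappa>" using off Zm \<theta> by simp
    \<comment> \<open>\<open>I\<close> collects the levels from which \<open>n\<close> consecutive
      levels stay within one segment.\<close>
    define I where "I = {i. i < length t * L \<and> i mod L + n \<le> L}"
    define G where "G j = levels {i \<in> I. i div L = j}" for j
    define R where "R = (off \<union> Z) \<union> levels ({..<H} - I)"
    have cardI: "real (card ({..<H} - I)) \<le> \<theta> * real H"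
    proof -
      have "{i. i < length t * L \<and> i mod L < L - n} \<subseteq> I" by (auto simp: I_def)
      then have "card {i. i < length t * L \<and> i mod L < L - n} \<le> card I"
        by (intro card_mono) (auto simp: I_def)
      then have "length t * (L - n) \<le> card I" by (simp add: card_mod_less)
      then have "real (length t) * (real L - real n) \<le> real (card I)"
        using L(1) by (simp flip: of_nat_diff of_nat_mult)
      moreover have "I \<subseteq> {..<H}" using L(2) by (auto simp: I_def)
      then have "card ({..<H} - I) = H - card I" "card I \<le> H"
        using card_mono[of "{..<H}" I] by (auto simp: card_Diff_subset finite_subset)
      ultimately show ?thesis using dense by (simp add: of_nat_diff algebra_simps)
    qed
    have "measure M (levels ({..<H} - I)) \<le> real (card ({..<H} - I)) / real H"
      by (intro measure_levels) auto
    also have "\<dots> \<le> \<theta>" using cardI H by (simp add: field_simps)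
    finally have "measure M (levels ({..<H} - I)) \<le> \<theta>" .
    moreover have "measure M R \<le> measure M (off \<union> Z) + measure M (levels ({..<H} - I))"
      unfolding R_def by (rule measure_Un_le) auto
    moreover have "measure M (off \<union> Z) \<le> measure M off + measure M Z" by (rule measure_Un_le) auto
    ultimately have Rm: "measure M R \<le> \<gamma>" using off Zm \<theta> by simp
    have "levy_near (\<lambda>x. birkhoff_sum T (\<lambda>y. indicator A' y - c) n x / a n) t \<gamma>"
    proof (rule levy_near_partition)
      show "R \<in> sets M" unfolding R_def by measurable
      show "G j \<in> sets M" for j unfolding G_def by measurable
      show "measure M (G j) \<le> 1 / real (length t)" if "j < length t" for j
      proof -
        have "{i \<in> I. i div L = j} \<subseteq> {j * L..<Suc j * L}"
          using L0 by (auto simp: div_nat_eqI dividend_less_div_times)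
        then have "card {i \<in> I. i div L = j} \<le> card {j * L..<Suc j * L}" by (intro card_mono) auto
        then have "card {i \<in> I. i div L = j} \<le> L" by simp
        then have "card {i \<in> I. i div L = j} * length t \<le> H"
          using L(2) mult_le_mono1[of _ L "length t"] by (metis le_trans mult.commute)
        then have "real (card {i \<in> I. i div L = j}) * real (length t) \<le> real H"
          by (simp flip: of_nat_mult)
        then have "real (card {i \<in> I. i div L = j}) / real H \<le> 1 / real (length t)"
          using H(1) r0 by (simp add: field_simps)
        moreover have "measure M (G j) \<le> real (card {i \<in> I. i div L = j}) / real H"
          unfolding G_def by (intro measure_levels) (auto simp: I_def)
        ultimately show ?thesis by linarith
      qed
    next
      fix y assume y: "y \<in> space M - R"
      then obtain i where i: "i < H" "(S ^^ i) y \<in> Q" by (auto simp: R_def off_def)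
      have "i \<in> I" using y i by (auto simp: R_def levels_def)
      let ?j = "i div L"
      let ?W = "word A ((S ^^ i) y)"
      have j: "?j < length t" using \<open>i \<in> I\<close> by (auto simp: I_def less_mult_imp_div_less)
      have ge: "?j * L \<le> i" by simp
      have le: "i + n \<le> Suc ?j * L"
      proof -
        have "i mod L + n \<le> L" using \<open>i \<in> I\<close> by (simp add: I_def)
        moreover have "?j * L + i mod L = i" by (rule div_mult_mod_eq)
        moreover have "Suc ?j * L = ?j * L + L" by simp
        ultimately show ?thesis by linarith
      qed
      have "Suc ?j * L \<le> length t * L" using j by (intro mult_right_mono) auto
      then have inH: "i + n \<le> H" using le L by linarith
      have "y \<in> space M - Z" using y by (auto simp: R_def)
      then have win: "\<bar>(\<Sum>k\<in>{i..<i+n}. indicator (F ?W) k - c) - a n * t ! ?j\<bar> \<le> \<theta> * a n"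
        using F[of ?W] column[of y i] i(1) j ge le by (auto simp: rep_def)
      \<comment> \<open>The first \<open>n\<close> points of the orbit of \<open>y\<close> occupy
        the levels from \<open>i\<close> to \<open>i + n - 1\<close> of its column, so the sum is a
        window sum of the new word.\<close>
      have "birkhoff_sum T (\<lambda>y. indicator A' y - c) n y = (\<Sum>m<n. indicator (F ?W) (m + i) - c)"
        unfolding birkhoff_sum_def
      proof (intro sum.cong refl)
        fix m assume m: "m \<in> {..<n}"
        have sp: "y \<in> space M" using y by simp
        have "(T ^^ (m + i)) ((S ^^ i) y) \<in> A' \<longleftrightarrow> m + i \<in> F ?W"
          unfolding A'_def using m inH i sp by (intro rewrite_iff_column) (auto simp: funpow_S_space)
        moreover have "(T ^^ (m + i)) ((S ^^ i) y) = (T ^^ m) y"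
          using sp by (simp add: funpow_T_S')
        ultimately show "indicator A' ((T ^^ m) y) - c = indicator (F ?W) (m + i) - c"
          by (simp add: indicator_def)
      qed
      also have "\<dots> = (\<Sum>k\<in>{i..<i+n}. indicator (F ?W) k - c)"
        using sum.shift_bounds_nat_ivl[of "\<lambda>k. indicator (F ?W) k - c" 0 i n]
        by (simp add: atLeast0LessThan add.commute)
      finally have B: "\<bar>birkhoff_sum T (\<lambda>y. indicator A' y - c) n y - a n * t ! ?j\<bar> \<le> \<theta> * a n"
        using win by simp
      have "birkhoff_sum T (\<lambda>y. indicator A' y - c) n y / a n - t ! ?j
          = (birkhoff_sum T (\<lambda>y. indicator A' y - c) n y - a n * t ! ?j) / a n"
        using a(1)[of n] by (simp add: diff_divide_distrib)
      then have "\<bar>birkhoff_sum T (\<lambda>y. indicator A' y - c) n y / a n - t ! ?j\<bar> \<le> \<theta>"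
        using B a(1)[of n] by (simp add: abs_divide divide_le_eq)
      then have "\<bar>birkhoff_sum T (\<lambda>y. indicator A' y - c) n y / a n - t ! ?j\<bar> \<le> \<gamma>"
        using \<theta> by linarith
      moreover have "y \<in> G ?j" using \<open>i \<in> I\<close> i y by (auto simp: G_def levels_def)
      ultimately show "\<exists>j<length t. y \<in> G j \<and>
          \<bar>birkhoff_sum T (\<lambda>y. indicator A' y - c) n y / a n - t ! j\<bar> \<le> \<gamma>"
        using j by blast
    qed (use t Rm in \<open>auto intro!: birkhoff_sum_measurable borel_measurable_divide\<close>)
    then show ?thesis using A' bal' diff by blast
  qed
  have meas: "\<bar>measure M A - c\<bar> \<le> \<kappa>" if "A \<in> sets M" "balanced c A K \<delta>" for A
    using balanced_measure[OF that c K] \<delta>1 by linarith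
  show ?thesis
    unfolding c_def[symmetric]
    using n \<delta> main meas by (intro exI[of _ n] exI[of _ \<delta>] exI[of _ "real H"] conjI) auto
qed

end

section \<open>Approximation of laws by empirical measures of rational lists\<close>

lemma card_midpoints_le:
  fixes r :: nat and v :: real
  assumes v: "0 \<le> v" "v \<le> 1"
  shows "\<bar>real (card {j. j < r \<and> (real j + 1/2) / real r \<le> v}) - real r * v\<bar> \<le> 1"
proof (cases "r = 0")
  case False
  let ?J = "{j. j < r \<and> (real j + 1/2) / real r \<le> v}"
  have J: "?J = {j. j < r \<and> real j + 1/2 \<le> real r * v}" using False by (auto simp: field_simps)
  have rv: "0 \<le> real r * v" "real r * v \<le> real r" using v by (auto simp: mult_left_le)
  have "?J \<subseteq> {..<nat \<lceil>real r * v\<rceil>}"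
    unfolding J by (auto simp: zless_nat_eq_int_zless less_ceiling_iff)
  then have "card ?J \<le> nat \<lceil>real r * v\<rceil>" using card_mono[of "{..<nat \<lceil>real r * v\<rceil>}" ?J] by simp
  moreover have "{..<nat \<lfloor>real r * v\<rfloor>} \<subseteq> ?J"
  proof
    fix j assume "j \<in> {..<nat \<lfloor>real r * v\<rfloor>}"
    then have "int (Suc j) \<le> \<lfloor>real r * v\<rfloor>" by auto
    then have "real j + 1 \<le> real r * v" by (simp add: le_floor_iff)
    then show "j \<in> ?J" unfolding J using rv(2) by auto
  qed
  then have "nat \<lfloor>real r * v\<rfloor> \<le> card ?J" using card_mono[of ?J "{..<nat \<lfloor>real r * v\<rfloor>}"] by simp
  ultimately show ?thesis using rv by (auto simp: abs_le_iff) linarith+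
qed simp

text \<open>Sample the quantile function at \<open>r\<close> equally spaced midpoints and round up
  to rationals within \<open>\<gamma>\<close>. The number of midpoints up to a value of the cdf is
  \<open>r\<close> times that value up to an error of 1, which amounts to 1 / \<open>r\<close> <=
  \<open>\<gamma>\<close>.\<close>

lemma ecdf_approx:
  assumes "real_distribution \<nu>" and \<gamma>: "\<gamma> > 0"
  obtains t :: "rat list" where "t \<noteq> []"
    "\<And>x. ecdf (map of_rat t) x \<le> cdf \<nu> x + \<gamma>"
    "\<And>x. cdf \<nu> (x - \<gamma>) - \<gamma> \<le> ecdf (map of_rat t) x"
proof -
  interpret cdf_distribution \<nu> by (simp add: cdf_distribution_def assms(1))
  define r where "r = Suc (nat \<lceil>1 / \<gamma>\<rceil>)"
  have r: "r > 0" by (simp add: r_def)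
  have "1 / \<gamma> \<le> real r" unfolding r_def by linarith
  then have r\<gamma>: "1 / real r \<le> \<gamma>" using \<gamma> r by (simp add: field_simps)
  \<comment> \<open>Midpoints lie strictly between 0 and 1, where the quantile function
    \<open>I\<close> obeys \<open>pseudoinverse\<close>.\<close>
  define u where "u j = (real j + 1/2) / real r" for j
  have "\<exists>s::rat. I (u j) < of_rat s \<and> of_rat s < I (u j) + \<gamma>" for j
    using of_rat_dense[of "I (u j)" "I (u j) + \<gamma>"] \<gamma> by auto
  then obtain s :: "nat \<Rightarrow> rat" where s: "\<And>j. I (u j) < of_rat (s j)" "\<And>j. of_rat (s j) < I (u j) + \<gamma>"
    by metis
  have ps: "u j \<le> cdf \<nu> x \<longleftrightarrow> I (u j) \<le> x" if "j < r" for j x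
    using that by (intro pseudoinverse) (auto simp: u_def field_simps)
  define t where "t = map s [0..<r]"
  have e: "ecdf (map of_rat t) x = real (card {j. j < r \<and> of_rat (s j) \<le> x}) / real r" for x
    unfolding ecdf_def t_def by (simp cong: conj_cong)
  have cnt: "real r * cdf \<nu> x - 1 \<le> real (card {j. j < r \<and> u j \<le> cdf \<nu> x})"
    "real (card {j. j < r \<and> u j \<le> cdf \<nu> x}) \<le> real r * cdf \<nu> x + 1" for x
    using card_midpoints_le[of "cdf \<nu> x" r] cdf_nonneg[of x] cdf_bounded_prob[of x]
    unfolding u_def by (auto simp: abs_le_iff)
  show ?thesis
  proof (rule that[of t])
    show "t \<noteq> []" using r by (simp add: t_def)
  next
    fix x
    have "{j. j < r \<and> of_rat (s j) \<le> x} \<subseteq> {j. j < r \<and> u j \<le> cdf \<nu> x}"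
      using ps s(1) by (auto simp: less_imp_le intro: order_trans[OF less_imp_le[OF s(1)]])
    then have "card {j. j < r \<and> of_rat (s j) \<le> x} \<le> card {j. j < r \<and> u j \<le> cdf \<nu> x}"
      by (intro card_mono) auto
    then have "real (card {j. j < r \<and> of_rat (s j) \<le> x}) \<le> real r * cdf \<nu> x + 1"
      using cnt(2)[of x] by linarith
    then have "ecdf (map of_rat t) x \<le> (real r * cdf \<nu> x + 1) / real r"
      unfolding e using r by (intro divide_right_mono) auto
    also have "\<dots> = cdf \<nu> x + 1 / real r" using r by (simp add: field_simps)
    finally show "ecdf (map of_rat t) x \<le> cdf \<nu> x + \<gamma>" using r\<gamma> by linarith
  next
    fix x
    have "{j. j < r \<and> u j \<le> cdf \<nu> (x - \<gamma>)} \<subseteq> {j. j < r \<and> of_rat (s j) \<le> x}"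
    proof safe
      fix j assume "j < r" "u j \<le> cdf \<nu> (x - \<gamma>)"
      then have "I (u j) \<le> x - \<gamma>" using ps by blast
      then show "of_rat (s j) \<le> x" using s(2)[of j] by linarith
    qed
    then have "card {j. j < r \<and> u j \<le> cdf \<nu> (x - \<gamma>)} \<le> card {j. j < r \<and> of_rat (s j) \<le> x}"
      by (intro card_mono) auto
    then have "real r * cdf \<nu> (x - \<gamma>) - 1 \<le> real (card {j. j < r \<and> of_rat (s j) \<le> x})"
      using cnt(1)[of "x - \<gamma>"] by linarith
    then have "(real r * cdf \<nu> (x - \<gamma>) - 1) / real r \<le> ecdf (map of_rat t) x"
      unfolding e using r by (intro divide_right_mono) auto
    moreover have "(real r * cdf \<nu> (x - \<gamma>) - 1) / real r = cdf \<nu> (x - \<gamma>) - 1 / real r"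
      using r by (simp add: field_simps)
    ultimately show "cdf \<nu> (x - \<gamma>) - \<gamma> \<le> ecdf (map of_rat t) x" using r\<gamma> by linarith
  qed
qed

section \<open>The limit set\<close>

context aperiodic_system
begin

text \<open>Stage \<open>s\<close> treats one pair of a precision and a rational list. All scales
  are fixed by recursion before any set is chosen, so each set can be prepared to the tolerance
  which the next stage demands, and all later changes are small compared to 1 /
  \<open>n s\<close>.\<close>

lemma universal_set:
  fixes a :: "nat \<Rightarrow> real" and q :: nat
  assumes q: "q \<ge> 2"
    and a: "\<And>n. a n > 0" "filterlim a at_top sequentially" "(\<lambda>n. a n / real n) \<longlonglongrightarrow> 0"
  shows "\<exists>A\<in>sets M. measure M A = 1 / real q \<and>
    (\<forall>(t::rat list) m::nat. t \<noteq> [] \<longrightarrow> (\<exists>n>0.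
      levy_near (\<lambda>x. birkhoff_sum T (\<lambda>y. indicator A y - 1 / real q) n x / a n) (map of_rat t) (2 / real (Suc m))))"
proof -
  define c where "c = 1 / real q"
  \<comment> \<open>Coding a list by head and tail makes every index give a nonempty list, and every
    pair of a precision and such a list occurs.\<close>
  define tt :: "nat \<Rightarrow> real list" where "tt s = (case from_nat s of (m::nat, x::rat, xs) \<Rightarrow> map of_rat (x # xs))" for s
  define \<gamma> where "\<gamma> s = (case from_nat s of (m::nat, x::rat, xs::rat list) \<Rightarrow> 1 / real (Suc m))" for s
  have tt: "tt s \<noteq> []" for s by (simp add: tt_def split: prod.splits)
  have \<gamma>: "\<gamma> s > 0" for s by (simp add: \<gamma>_def split: prod.splits)
  define Y where "Y A n x = birkhoff_sum T (\<lambda>y. indicator A y - c) n x / a n" for A n x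
  have Y_meas [measurable]: "Y A n \<in> borel_measurable M" if [measurable]: "A \<in> sets M" for A n
    unfolding Y_def by (intro borel_measurable_divide birkhoff_sum_measurable) measurable
  define P where "P s K \<kappa> n \<delta> K' \<longleftrightarrow> n > 0 \<and> \<delta> > 0 \<and> K' \<ge> 0 \<and> (\<forall>A\<in>sets M. balanced c A K \<delta> \<longrightarrow>
    \<bar>measure M A - c\<bar> \<le> \<kappa> \<and>
    (\<forall>\<delta>'>0. \<exists>A'\<in>sets M. balanced c A' K' \<delta>' \<and> measure M (sym_diff A A') \<le> \<kappa> \<and>
       levy_near (Y A' n) (tt s) (\<gamma> s)))" for s K \<kappa> n \<delta> K'
  define w where "w s K \<kappa> = (SOME w. P s K \<kappa> (fst w) (fst (snd w)) (snd (snd w)))" for s K \<kappa>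
  define fn fd fK where "fn s K \<kappa> = fst (w s K \<kappa>)" and "fd s K \<kappa> = fst (snd (w s K \<kappa>))"
    and "fK s K \<kappa> = snd (snd (w s K \<kappa>))" for s K \<kappa>
  have f: "P s K \<kappa> (fn s K \<kappa>) (fd s K \<kappa>) (fK s K \<kappa>)" if "K \<ge> 0" "\<kappa> > 0" for s K \<kappa>
  proof -
    have "\<exists>n \<delta> K'. P s K \<kappa> n \<delta> K'"
      using balanced_step[OF q _ tt \<gamma> _ a, of K \<kappa> s s] that unfolding P_def Y_def c_def by blast
    then have "\<exists>w. P s K \<kappa> (fst w) (fst (snd w)) (snd (snd w))" by auto
    then show ?thesis unfolding fn_def fd_def fK_def w_def by (rule someI_ex)
  qed
  \<comment> \<open>The initial value \<open>q\<close> is the bound of the initial tower set.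
    Halving makes the changes summable; the second bound makes those after stage \<open>s\<close>,
    at most \<open>2 * \<kappa> (Suc s)\<close> in total, affect sums of length \<open>n s\<close>
    only with probability at most \<open>\<gamma> s\<close>.\<close>
  define st where "st = rec_nat (real q, 1) (\<lambda>s (K, \<kappa>). (fK s K \<kappa>, min (\<kappa> / 2) (\<gamma> s / (2 * real (fn s K \<kappa>)))))"
  define K where "K s = fst (st s)" for s
  define \<kappa> where "\<kappa> s = snd (st s)" for s
  define n where "n s = fn s (K s) (\<kappa> s)" for s
  define \<delta> where "\<delta> s = fd s (K s) (\<kappa> s)" for s
  have K0: "K 0 = real q" and \<kappa>0: "\<kappa> 0 = 1" by (auto simp: K_def \<kappa>_def st_def)
  have KS: "K (Suc s) = fK s (K s) (\<kappa> s)" for s by (simp add: K_def \<kappa>_def st_def split: prod.splits)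
  have \<kappa>S: "\<kappa> (Suc s) = min (\<kappa> s / 2) (\<gamma> s / (2 * real (n s)))" for s
    by (simp add: K_def \<kappa>_def n_def st_def split: prod.splits)
  have inv: "K s \<ge> 0 \<and> \<kappa> s > 0" for s
  proof (induction s)
    case 0 then show ?case by (simp add: K0 \<kappa>0)
  next
    case (Suc s)
    then show ?case using f[of "K s" "\<kappa> s" s] \<gamma>[of s] unfolding P_def KS \<kappa>S n_def by auto
  qed
  have P: "P s (K s) (\<kappa> s) (n s) (\<delta> s) (K (Suc s))" for s
    using f inv unfolding n_def \<delta>_def KS by blast
  have "\<exists>A. \<forall>s. (A s \<in> sets M \<and> balanced c (A s) (K s) (\<delta> s)) \<and>
    (measure M (sym_diff (A s) (A (Suc s))) \<le> \<kappa> s \<and> levy_near (Y (A (Suc s)) (n s)) (tt s) (\<gamma> s))"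
  proof (rule dependent_nat_choice)
    show "\<exists>A. A \<in> sets M \<and> balanced c A (K 0) (\<delta> 0)"
      using balanced_exists[of q "\<delta> 0"] q P[of 0] unfolding K0 c_def P_def by auto
  next
    fix A s assume "A \<in> sets M \<and> balanced c A (K s) (\<delta> s)"
    moreover have "\<delta> (Suc s) > 0" using P[of "Suc s"] by (simp add: P_def)
    ultimately show "\<exists>A'. (A' \<in> sets M \<and> balanced c A' (K (Suc s)) (\<delta> (Suc s))) \<and>
       measure M (sym_diff A A') \<le> \<kappa> s \<and> levy_near (Y A' (n s)) (tt s) (\<gamma> s)"
      using P[of s] unfolding P_def by blast
  qed
  then obtain A where A [measurable]: "\<And>s. A s \<in> sets M" and bal: "\<And>s. balanced c (A s) (K s) (\<delta> s)"
    and diff: "\<And>s. measure M (sym_diff (A s) (A (Suc s))) \<le> \<kappa> s"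
    and near: "\<And>s. levy_near (Y (A (Suc s)) (n s)) (tt s) (\<gamma> s)" by blast
  \<comment> \<open>\<open>B\<close> is the lower limit of the sets \<open>A s\<close>.\<close>
  define B where "B = {x \<in> space M. \<exists>s. \<forall>j\<ge>s. x \<in> A j}"
  have B [measurable]: "B \<in> sets M" unfolding B_def by measurable
  have geo: "\<kappa> (s + j) \<le> \<kappa> s * (1/2) ^ j" for s j
  proof (induction j)
    case (Suc j)
    have "\<kappa> (s + Suc j) \<le> \<kappa> (s + j) / 2" using \<kappa>S[of "s + j"] by simp
    then show ?case using Suc by simp
  qed simp
  have BA: "measure M (sym_diff (A s) B) \<le> 2 * \<kappa> s" for s
  proof -
    let ?D = "\<lambda>j. sym_diff (A (s + j)) (A (s + Suc j))"
    have le: "measure M (?D j) \<le> \<kappa> s * (1/2) ^ j" for j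
      using diff[of "s + j"] geo[of s j] by simp
    have sg: "summable (\<lambda>j. \<kappa> s * (1/2) ^ j)" by (intro summable_mult summable_geometric) auto
    have sm: "summable (\<lambda>j. measure M (?D j))"
      by (rule summable_comparison_test'[OF sg]) (use le in auto)
    \<comment> \<open>A point outside all these differences keeps its status from stage
      \<open>s\<close> on, hence also in the lower limit.\<close>
    have "sym_diff (A s) B \<subseteq> (\<Union>j. ?D j)"
    proof
      fix x assume x: "x \<in> sym_diff (A s) B"
      then have sp: "x \<in> space M" using sets.sets_into_space[OF A] sets.sets_into_space[OF B] by blast
      show "x \<in> (\<Union>j. ?D j)"
      proof (rule ccontr)
        assume n: "x \<notin> (\<Union>j. ?D j)"
        have "x \<in> A (s + j) \<longleftrightarrow> x \<in> A s" for j
        proof (induction j)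
          case (Suc j)
          have "x \<notin> ?D j" using n by blast
          then show ?case using Suc by auto
        qed simp
        then have eq: "x \<in> A j \<longleftrightarrow> x \<in> A s" if "j \<ge> s" for j using that by (metis le_add_diff_inverse)
        have "x \<in> B \<longleftrightarrow> x \<in> A s"
        proof
          assume "x \<in> B"
          then obtain i where "\<forall>j\<ge>i. x \<in> A j" by (auto simp: B_def)
          then have "x \<in> A (max i s)" by simp
          then show "x \<in> A s" using eq[of "max i s"] by simp
        next
          assume "x \<in> A s"
          then show "x \<in> B" unfolding B_def using eq sp by blast
        qed
        then show False using x by blast
      qed
    qed
    then have "measure M (sym_diff (A s) B) \<le> measure M (\<Union>j. ?D j)"
      by (intro finite_measure_mono) auto
    also have "\<dots> \<le> (\<Sum>j. measure M (?D j))"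
      by (rule finite_measure_subadditive_countably[OF _ sm]) auto
    also have "\<dots> \<le> (\<Sum>j. \<kappa> s * (1/2) ^ j)" by (rule suminf_le[OF le sm sg])
    also have "\<dots> = 2 * \<kappa> s" by (simp add: suminf_mult suminf_geometric)
    finally show ?thesis .
  qed
  have "measure M B = c"
  proof -
    \<comment> \<open>The distance from \<open>B\<close> to \<open>A s\<close> and the deviation of
      the measure of \<open>A s\<close> from \<open>c\<close> both tend to 0, which makes the
      measure of \<open>B\<close> exactly \<open>c\<close>.\<close>
    have le: "\<bar>measure M B - c\<bar> \<le> 3 * (1/2) ^ s" for s
    proof -
      have "measure M B \<le> measure M (A s \<union> sym_diff (A s) B)" by (intro finite_measure_mono) auto
      also have "\<dots> \<le> measure M (A s) + measure M (sym_diff (A s) B)" by (rule measure_Un_le) auto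
      finally have 1: "measure M B \<le> measure M (A s) + 2 * \<kappa> s" using BA[of s] by linarith
      have "measure M (A s) \<le> measure M (B \<union> sym_diff (A s) B)" by (intro finite_measure_mono) auto
      also have "\<dots> \<le> measure M B + measure M (sym_diff (A s) B)" by (rule measure_Un_le) auto
      finally have 2: "measure M (A s) \<le> measure M B + 2 * \<kappa> s" using BA[of s] by linarith
      have "\<bar>measure M (A s) - c\<bar> \<le> \<kappa> s" using P[of s] A bal unfolding P_def by blast
      then have "\<bar>measure M B - c\<bar> \<le> 3 * \<kappa> s" using 1 2 by linarith
      also have "\<dots> \<le> 3 * (1/2) ^ s" using geo[of 0 s] \<kappa>0 by simp
      finally show ?thesis .
    qed
    have "(\<lambda>s. 3 * (1/2) ^ s :: real) \<longlonglongrightarrow> 3 * 0"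
      by (intro tendsto_mult tendsto_const LIMSEQ_power_zero) auto
    then have "\<bar>measure M B - c\<bar> \<le> 3 * 0"
      by (rule LIMSEQ_le_const) (use le in blast)
    then show ?thesis by simp
  qed
  have nearB: "levy_near (Y B (n s)) (tt s) (2 * \<gamma> s)" for s
  proof -
    let ?D = "sym_diff (A (Suc s)) B"
    have n: "n s > 0" using P by (simp add: P_def)
    \<comment> \<open>The two sums coincide unless one of the first \<open>n s\<close> orbit points
      lies in \<open>?D\<close>.\<close>
    have "{y \<in> space M. \<bar>Y (A (Suc s)) (n s) y - Y B (n s) y\<bar> > \<gamma> s} \<subseteq>
      (\<Union>i\<in>{..<n s}. {y \<in> space M. (T ^^ i) y \<in> ?D})"
    proof
      fix y assume y: "y \<in> {y \<in> space M. \<bar>Y (A (Suc s)) (n s) y - Y B (n s) y\<bar> > \<gamma> s}"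
      show "y \<in> (\<Union>i\<in>{..<n s}. {y \<in> space M. (T ^^ i) y \<in> ?D})"
      proof (rule ccontr)
        assume "\<not> ?thesis"
        then have "(T ^^ i) y \<in> A (Suc s) \<longleftrightarrow> (T ^^ i) y \<in> B" if "i < n s" for i using y that by blast
        then have "Y (A (Suc s)) (n s) y = Y B (n s) y"
          unfolding Y_def birkhoff_sum_def by (intro arg_cong2[where f="(/)"] sum.cong) (auto simp: indicator_def)
        then show False using y \<gamma>[of s] by simp
      qed
    qed
    then have "measure M {y \<in> space M. \<bar>Y (A (Suc s)) (n s) y - Y B (n s) y\<bar> > \<gamma> s} \<le>
      measure M (\<Union>i\<in>{..<n s}. {y \<in> space M. (T ^^ i) y \<in> ?D})"
      by (intro finite_measure_mono) auto
    also have "\<dots> \<le> real (card {..<n s}) * (2 * \<kappa> (Suc s))"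
    proof (rule measure_UN_le)
      show "measure M {y \<in> space M. (T ^^ i) y \<in> ?D} \<le> 2 * \<kappa> (Suc s)" for i
        by (subst measure_T) (use BA in auto)
    qed auto
    also have "\<dots> \<le> \<gamma> s"
    proof -
      have "\<kappa> (Suc s) \<le> \<gamma> s / (2 * real (n s))" using \<kappa>S[of s] by simp
      then show ?thesis using n by (simp add: field_simps)
    qed
    finally have "levy_near (Y B (n s)) (tt s) (\<gamma> s + \<gamma> s)"
      by (intro levy_near_perturb[OF _ _ near]) auto
    then show ?thesis by simp
  qed
  show ?thesis
  proof (intro bexI[of _ B] conjI allI impI)
    show "measure M B = 1 / real q" using \<open>measure M B = c\<close> by (simp add: c_def)
  next
    fix t :: "rat list" and m :: nat assume "t \<noteq> []"
    then obtain x xs where t: "t = x # xs" by (cases t) auto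
    define s where "s = to_nat (m, x, xs)"
    have "tt s = map of_rat t" "\<gamma> s = 1 / real (Suc m)" by (simp_all add: tt_def \<gamma>_def s_def t)
    then have "levy_near (Y B (n s)) (map of_rat t) (2 / real (Suc m))" using nearB[of s] by simp
    moreover have "n s > 0" using P by (simp add: P_def)
    ultimately show "\<exists>n>0. levy_near (\<lambda>x. birkhoff_sum T (\<lambda>y. indicator B y - 1 / real q) n x / a n)
        (map of_rat t) (2 / real (Suc m))"
      unfolding Y_def c_def by blast
  qed fact
qed

end

section \<open>Weak convergence and Lebesgue spaces\<close>

text \<open>At a continuity point of the limit cdf both bounds converge to its value there.\<close>

lemma weak_conv_squeeze:
  assumes e: "e \<longlonglongrightarrow> 0"
    and le: "\<And>k x. cdf (N k) x \<le> cdf \<nu> (x + e k) + e k"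
    and ge: "\<And>k x. cdf \<nu> (x - e k) - e k \<le> cdf (N k) x"
  shows "weak_conv_m N \<nu>"
  unfolding weak_conv_m_def weak_conv_def
proof (intro allI impI)
  fix x assume cont: "isCont (cdf \<nu>) x"
  have "(\<lambda>k. x + e k) \<longlonglongrightarrow> x" "(\<lambda>k. x - e k) \<longlonglongrightarrow> x"
    using tendsto_add[OF tendsto_const e, of x] tendsto_diff[OF tendsto_const e, of x] by simp_all
  then have "(\<lambda>k. cdf \<nu> (x + e k)) \<longlonglongrightarrow> cdf \<nu> x" "(\<lambda>k. cdf \<nu> (x - e k)) \<longlonglongrightarrow> cdf \<nu> x"
    using isCont_tendsto_compose[OF cont] by blast+
  then have upper: "(\<lambda>k. cdf \<nu> (x + e k) + e k) \<longlonglongrightarrow> cdf \<nu> x"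
    and lower: "(\<lambda>k. cdf \<nu> (x - e k) - e k) \<longlonglongrightarrow> cdf \<nu> x"
    using tendsto_add[OF _ e] tendsto_diff[OF _ e] by fastforce+
  show "(\<lambda>k. cdf (N k) x) \<longlonglongrightarrow> cdf \<nu> x"
    by (rule tendsto_sandwich[OF always_eventually always_eventually lower upper]) (simp_all add: le ge)
qed

text \<open>Singletons isolate the atoms; on the remaining part, preimages of rational half-lines
  under the injective \<open>\<phi>\<close> separate points.\<close>

lemma lebesgue_space_separating:
  assumes "lebesgue_space M"
  obtains \<D> N where "countable \<D>" "\<D> \<subseteq> sets M" "N \<in> null_sets M"
    "\<And>x y. x \<in> space M - N \<Longrightarrow> y \<in> space M - N \<Longrightarrow> x \<noteq> y \<Longrightarrow> \<exists>D\<in>\<D>. (x \<in> D) \<noteq> (y \<in> D)"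
proof -
  obtain C s where C: "countable C" "C \<subseteq> space M" "\<And>x. x \<in> C \<Longrightarrow> {x} \<in> sets M"
    and iso: "isomorphic_mod0 (restrict_space M (space M - C)) (lebesgue_on {0..s::real})"
    using assms unfolding lebesgue_space_def by blast
  have "(\<Union>x\<in>C. {x}) \<in> sets M" using C by (intro sets.countable_UN'') auto
  then have C_sets [measurable]: "C \<in> sets M" by simp
  let ?R = "restrict_space M (space M - C)"
  let ?L = "lebesgue_on {0..s}"
  obtain X Y \<phi> where X: "X \<in> sets ?R" and Y: "Y \<in> sets ?L" and nullX: "space ?R - X \<in> null_sets ?R"
    and bij: "bij_betw \<phi> X Y" and \<phi>: "\<phi> \<in> measurable (restrict_space ?R X) (restrict_space ?L Y)"
    using iso unfolding isomorphic_mod0_def by blast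
  have spR: "space ?R = space M - C" by (auto simp: space_restrict_space)
  have XM: "X \<in> sets M" "X \<subseteq> space M - C"
    using X by (auto simp: sets_restrict_space_iff)
  have null: "space M - C - X \<in> null_sets M"
    using nullX unfolding spR by (simp add: null_sets_restrict_space)
  define V where "V q = \<phi> -` {..real_of_rat q} \<inter> X" for q
  have V: "V q \<in> sets M" for q
  proof -
    \<comment> \<open>Cutting the half-line down to \<open>Y\<close> makes it a measurable set of
      the target and leaves its preimage unchanged.\<close>
    have "{..real_of_rat q} \<inter> ({0..s} \<inter> Y) \<in> sets (restrict_space ?L Y)"
    proof -
      have "{..real_of_rat q} \<inter> {0..s} \<in> sets ?L" by (auto simp: sets_restrict_space_iff)
      then show ?thesis
        unfolding sets_restrict_space[of ?L Y] by (rule rev_image_eqI) auto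
    qed
    from measurable_sets[OF \<phi> this]
    have "\<phi> -` ({..real_of_rat q} \<inter> ({0..s} \<inter> Y)) \<inter> space (restrict_space ?R X) \<in> sets (restrict_space ?R X)" .
    moreover have "Y \<subseteq> {0..s}" using sets.sets_into_space[OF Y] by simp
    then have "\<phi> -` ({..real_of_rat q} \<inter> ({0..s} \<inter> Y)) \<inter> space (restrict_space ?R X) = V q"
      using bij XM unfolding V_def by (auto simp: space_restrict_space bij_betw_def)
    ultimately have "V q \<in> sets (restrict_space ?R X)" by simp
    then have "V q \<in> sets ?R" using X by (auto simp: sets_restrict_space[of ?R X])
    then show ?thesis by (auto simp: sets_restrict_space)
  qed
  show ?thesis
  proof (rule that[of "(\<lambda>x. {x}) ` C \<union> range V" "space M - C - X"])
    show "countable ((\<lambda>x. {x}) ` C \<union> range V)" using C by auto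
    show "(\<lambda>x. {x}) ` C \<union> range V \<subseteq> sets M" using C V by auto
    show "space M - C - X \<in> null_sets M" by fact
  next
    fix x y assume x: "x \<in> space M - (space M - C - X)" and y: "y \<in> space M - (space M - C - X)" and "x \<noteq> y"
    show "\<exists>D\<in>(\<lambda>x. {x}) ` C \<union> range V. (x \<in> D) \<noteq> (y \<in> D)"
    proof (cases "x \<in> C \<or> y \<in> C")
      case True
      then show ?thesis using \<open>x \<noteq> y\<close> by (auto intro: bexI[of _ "{x}"] bexI[of _ "{y}"])
    next
      case False
      then have "x \<in> X" "y \<in> X" using x y by auto
      then have "\<phi> x \<noteq> \<phi> y" using bij \<open>x \<noteq> y\<close> by (auto simp: bij_betw_def inj_on_def)
      then have "min (\<phi> x) (\<phi> y) < max (\<phi> x) (\<phi> y)" by linarith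
      from of_rat_dense[OF this]
      obtain q where "min (\<phi> x) (\<phi> y) < of_rat q" "of_rat q < max (\<phi> x) (\<phi> y)" by blast
      then have "(x \<in> V q) \<noteq> (y \<in> V q)"
        using \<open>x \<in> X\<close> \<open>y \<in> X\<close> by (auto simp: V_def min_def max_def split: if_splits)
      then show ?thesis by blast
    qed
  qed
qed

text \<open>Supplies the inverse map and the separating family on which the construction
  rests.\<close>

lemma aperiodic_systemI:
  assumes sys: "dynamical_system M T" and aper: "aperiodic M T"
  obtains S \<D> where "aperiodic_system M T S \<D>"
proof -
  have leb: "lebesgue_space M" and bij: "bij_betw T (space M) (space M)"
    and T: "T \<in> measurable M M" and S: "the_inv_into (space M) T \<in> measurable M M"
    and d: "distr M M T = M"
    using sys by (auto simp: dynamical_system_def invertible_measure_preserving_def)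
  interpret prob_space M using leb by (simp add: lebesgue_space_def)
  interpret mp_system M T "the_inv_into (space M) T"
    using bij T S d
    by unfold_locales (auto simp: bij_betw_def the_inv_into_f_f f_the_inv_into_f)
  obtain \<D> N where \<D>: "countable \<D>" "\<D> \<subseteq> sets M" "N \<in> null_sets M"
    "\<And>x y. x \<in> space M - N \<Longrightarrow> y \<in> space M - N \<Longrightarrow> x \<noteq> y \<Longrightarrow> \<exists>D\<in>\<D>. (x \<in> D) \<noteq> (y \<in> D)"
    using lebesgue_space_separating[OF leb] by blast
  have "AE x in M. \<forall>n\<ge>1. (T ^^ n) x \<noteq> x"
    using aper unfolding aperiodic_def by (intro AE_I') auto
  moreover have "separating \<D>"
    unfolding separating_def
    using \<D> by blast
  ultimately have "aperiodic_system M T (the_inv_into (space M) T) \<D>"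
    by unfold_locales
  then show ?thesis by (rule that)
qed

theorem theorem2:
  fixes M :: "'a measure" and T :: "'a \<Rightarrow> 'a" and a :: "nat \<Rightarrow> real" and \<epsilon> :: real
  assumes "dynamical_system M T"
    and "aperiodic M T"
    and "\<And>n. a n > 0"
    and "incseq a"
    and "filterlim a at_top sequentially"
    and "(\<lambda>n. a n / real n) \<longlonglongrightarrow> 0"
    and "\<epsilon> > 0"
  shows "\<exists>A\<in>sets M. measure M A < \<epsilon> \<and>
           (\<forall>\<nu>. real_distribution \<nu> \<longrightarrow>
              (\<exists>n :: nat \<Rightarrow> nat. (\<forall>k. n k > 0) \<and>
                 weak_conv_m
                   (\<lambda>k. distr M borel
                      (\<lambda>x. 1 / a (n k) * birkhoff_sum T (\<lambda>y. indicator A y - measure M A) (n k) x))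
                   \<nu>))"
proof -
  obtain S \<D> where "aperiodic_system M T S \<D>" using aperiodic_systemI[OF assms(1,2)] by blast
  then interpret aperiodic_system M T S \<D> .
  obtain q0 :: nat where q0: "1 / \<epsilon> < real q0" using reals_Archimedean2 by blast
  \<comment> \<open>The summand 2 secures \<open>q\<close> >= 2 even for large
    \<open>\<epsilon>\<close>.\<close>
  define q where "q = q0 + 2"
  have q: "q \<ge> 2" "1 / real q < \<epsilon>"
    using q0 \<open>\<epsilon> > 0\<close> by (auto simp: q_def field_simps)
  obtain A where A [measurable]: "A \<in> sets M" and mA: "measure M A = 1 / real q"
    and near: "\<And>(t::rat list) m::nat. t \<noteq> [] \<Longrightarrow> \<exists>n>0.
      levy_near (\<lambda>x. birkhoff_sum T (\<lambda>y. indicator A y - 1 / real q) n x / a n) (map of_rat t) (2 / real (Suc m))"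
    using universal_set[OF q(1) assms(3,5,6)] by blast
  show ?thesis
  proof (intro bexI[of _ A] conjI allI impI)
    show "measure M A < \<epsilon>" using q mA by simp
  next
    fix \<nu> :: "real measure" assume \<nu>: "real_distribution \<nu>"
    let ?Y = "\<lambda>n x. birkhoff_sum T (\<lambda>y. indicator A y - 1 / real q) n x / a n"
    \<comment> \<open>Of the three parts of the error, one comes from replacing \<open>\<nu>\<close>
      by a rational list and two from the precision at which \<open>A\<close> realises that
      list.\<close>
    have "\<exists>n>0. \<forall>x. prob {y \<in> space M. ?Y n y \<le> x} \<le> cdf \<nu> (x + 3 / real (Suc k)) + 3 / real (Suc k) \<and>
       cdf \<nu> (x - 3 / real (Suc k)) - 3 / real (Suc k) \<le> prob {y \<in> space M. ?Y n y \<le> x}" for k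
    proof -
      let ?e = "1 / real (Suc k)"
      have "?e > 0" by simp
      then obtain t :: "rat list" where t: "t \<noteq> []"
        "\<And>x. ecdf (map of_rat t) x \<le> cdf \<nu> x + ?e"
        "\<And>x. cdf \<nu> (x - ?e) - ?e \<le> ecdf (map of_rat t) x"
        by (rule ecdf_approx[OF \<nu>]) (rule that; assumption)
      obtain n where n: "n > 0" "levy_near (?Y n) (map of_rat t) (2 / real (Suc k))"
        using near[OF t(1)] by blast
      interpret \<nu>: real_distribution \<nu> by fact
      show ?thesis
      proof (intro exI[of _ n] conjI allI)
        fix x
        have e3: "3 / real (Suc k) = 2 / real (Suc k) + ?e" by (simp add: field_simps)
        have "prob {y \<in> space M. ?Y n y \<le> x} \<le> cdf \<nu> (x + 2 / real (Suc k)) + ?e + 2 / real (Suc k)"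
          using conjunct1[OF n(2)[unfolded levy_near_def, rule_format, of x]] t(2)[of "x + 2 / real (Suc k)"]
          by linarith
        moreover have "cdf \<nu> (x + 2 / real (Suc k)) \<le> cdf \<nu> (x + 3 / real (Suc k))"
          by (intro \<nu>.cdf_nondecreasing) (simp add: divide_right_mono)
        ultimately show "prob {y \<in> space M. ?Y n y \<le> x} \<le> cdf \<nu> (x + 3 / real (Suc k)) + 3 / real (Suc k)"
          unfolding e3 by linarith
        have "ecdf (map of_rat t) (x - 2 / real (Suc k)) - 2 / real (Suc k) \<le> prob {y \<in> space M. ?Y n y \<le> x}"
          using n(2) by (simp add: levy_near_def)
        moreover have "cdf \<nu> (x - 3 / real (Suc k)) - ?e \<le> ecdf (map of_rat t) (x - 2 / real (Suc k))"
          using t(3)[of "x - 2 / real (Suc k)"] by (simp add: e3 diff_diff_eq)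
        ultimately show "cdf \<nu> (x - 3 / real (Suc k)) - 3 / real (Suc k) \<le> prob {y \<in> space M. ?Y n y \<le> x}"
          unfolding e3 by linarith
      qed fact
    qed
    then have "\<exists>n. \<forall>k. n k > 0 \<and> (\<forall>x. prob {y \<in> space M. ?Y (n k) y \<le> x} \<le> cdf \<nu> (x + 3 / real (Suc k)) + 3 / real (Suc k) \<and>
       cdf \<nu> (x - 3 / real (Suc k)) - 3 / real (Suc k) \<le> prob {y \<in> space M. ?Y (n k) y \<le> x})"
      by (intro choice allI)
    then obtain n where n0: "\<And>k. n k > 0"
      and n: "\<And>k x. prob {y \<in> space M. ?Y (n k) y \<le> x} \<le> cdf \<nu> (x + 3 / real (Suc k)) + 3 / real (Suc k)"
       "\<And>k x. cdf \<nu> (x - 3 / real (Suc k)) - 3 / real (Suc k) \<le> prob {y \<in> space M. ?Y (n k) y \<le> x}"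
      by blast
    have Ymeas: "?Y m \<in> borel_measurable M" for m
      by (intro borel_measurable_divide birkhoff_sum_measurable) measurable
    \<comment> \<open>Centering at 1 / \<open>q\<close> is centering at the measure of
      \<open>A\<close>, because the two are exactly equal.\<close>
    have eq: "(\<lambda>x. 1 / a m * birkhoff_sum T (\<lambda>y. indicator A y - measure M A) m x) = ?Y m" for m
      by (simp add: mA)
    have cdf: "cdf (distr M borel (?Y m)) x = prob {y \<in> space M. ?Y m y \<le> x}" for m x
      unfolding cdf_def by (subst measure_distr[OF Ymeas]) (auto intro!: arg_cong[where f = prob])
    show "\<exists>n :: nat \<Rightarrow> nat. (\<forall>k. n k > 0) \<and> weak_conv_m
        (\<lambda>k. distr M borel (\<lambda>x. 1 / a (n k) * birkhoff_sum T (\<lambda>y. indicator A y - measure M A) (n k) x)) \<nu>"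
      unfolding eq
    proof (intro exI[of _ n] conjI allI n0 weak_conv_squeeze)
      show "(\<lambda>k. 3 / real (Suc k)) \<longlonglongrightarrow> 0"
        by (rule LIMSEQ_Suc[OF lim_const_over_n])
    qed (use n in \<open>simp_all only: cdf\<close>)
  qed fact
qed

end
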